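(* Let $\Omega\subset\mathbb{C}$ be a simply connected open set, let $f$ and $g$ be analytic functions on $\Omega$, and let $A\in\mathbb{C}^{n\times n}$ and $B\in\mathbb{C}^{d\times d}$ be matrices whose spectra are both contained in $\Omega$. Let $\Gamma\subset\Omega$ be a simple closed rectifiable contour that strictly encloses the union of the spectra of $A$ and $B$ and winds once around it counterclockwise. With $\mathcal{D}_h(A,B,E)$ denoting the operator defined in the context, the following hold for every $E\in\mathbb{C}^{n\times d}$. 1. If $B=A$ (so $d=n$), then $\mathcal{D}_f(A,A,E)=L_f(A,E)$, where $L_f(A,\cdot)$ is the Fréchet derivative of the matrix function $f$ at $A$. 2. If $A=P_1T_1P_1^{-1}$ and $B=P_2T_2P_2^{-1}$ with $P_1,T_1\in\mathbb{C}^{n\times n}$, $P_2,T_2\in\mathbb{C}^{d\times d}$ and $P_1,P_2$ nonsingular, then $\mathcal{D}_f(A,B,E)=P_1\,\mathcal{D}_f(T_1,T_2,P_1^{-1}EP_2)\,P_2^{-1}$. 3. If $f$ is constant, then $\mathcal{D}_f(A,B,E)=0$. 4. (Sum rule) $\mathcal{D}_{f+g}(A,B,E)=\mathcal{D}_f(A,B,E)+\mathcal{D}_g(A,B,E)$. 5. (Product rule) $\mathcal{D}_{fg}(A,B,E)=f(A)\,\mathcal{D}_g(A,B,E)+\mathcal{D}_f(A,B,E)\,g(B)$. 6. (Chain rule) Assuming further that the union of the spectra of $g(A)$ and $g(B)$ is strictly enclosed in $\Gamma$, $\mathcal{D}_{f\circ g}(A,B,E)=\mathcal{D}_f\bigl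(g(A),g(B),\mathcal{D}_g(A,B,E)\bigr)$.
   Context: Definition of the operator. Let $h$ be an analytic function on a simply connected open set $\Omega\subset\mathbb{C}$ containing the union of the spectra of $A\in\mathbb{C}^{n\times n}$ and $B\in\mathbb{C}^{d\times d}$. For $E\in\mathbb{C}^{n\times d}$ define $$\mathcal{D}_h(A,B,E)=\frac{1}{2\pi \mathrm{i}}\int_\Gamma h(z)(zI_n-A)^{-1}E(zI_d-B)^{-1}\,\mathrm{d}z\in\mathbb{C}^{n\times d},$$ where $\Gamma\subset\Omega$ is a simple closed rectifiable contour that strictly encloses the union of the spectra of $A$ and $B$ and winds once around it in the counterclockwise direction. Equivalently, $\mathcal{D}_h(A,B,E)$ is the $(1,2)$ block of the matrix function $h\left(\begin{bmatrix}A&E\\0&B\end{bmatrix}\right)$, whose diagonal blocks are $h(A)$ and $h(B)$. Matrix functions $h(A)$ are defined by the Cauchy integral $h(A)=\frac{1}{2\pi \mathrm{i}}\int_\Gamma h(z)(zI-A)^{-1}\,\mathrm{d}z$. The Fréchet derivative of a matrix function $f$ at $A$ is the linear map $L_f(A,\cdot):\mathbb{C}^{n\times n}\to\mathbb{C}^{n\times n}$ such that $f(A+E)-f(A)-L_f(A,E)=o(\|E\|)$ as $E\to0$. *)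

theory Defs
  imports "HOL-Complex_Analysis.Complex_Analysis"
begin

definition rectifiable_path :: "(real \<Rightarrow> complex) \<Rightarrow> bool" where
  "rectifiable_path \<gamma> \<longleftrightarrow> path \<gamma> \<and>
     (\<exists>L. \<forall>\<D>. \<D> division_of {0..1} \<longrightarrow> (\<Sum>K\<in>\<D>. norm (\<gamma> (Sup K) - \<gamma> (Inf K))) \<le> L)"

text \<open>
  The line integral along a rectifiable path, as a limit of Riemann--Stieltjes sums when the
  mesh tends to zero. The library's \<^const>\<open>contour_integral\<close> is not used because it integrates
  against the derivative of the parametrisation, which does not give the line integral
  for a path that is merely of bounded variation (its derivative may vanish
  almost everywhere).
\<close>

definition has_line_integral ::
  "(complex \<Rightarrow> complex) \<Rightarrow> complex \<Rightarrow> (real \<Rightarrow> complex) \<Rightarrow> bool" where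
  "has_line_integral F I \<gamma> \<longleftrightarrow>
     (\<forall>e>0. \<exists>\<delta>>0. \<forall>\<D>. \<D> tagged_division_of {0..1} \<and> (\<forall>(t, K)\<in>\<D>. diameter K < \<delta>) \<longrightarrow>
        norm ((\<Sum>(t, K)\<in>\<D>. F (\<gamma> t) * (\<gamma> (Sup K) - \<gamma> (Inf K))) - I) < e)"

definition line_integral :: "(real \<Rightarrow> complex) \<Rightarrow> (complex \<Rightarrow> complex) \<Rightarrow> complex" where
  "line_integral \<gamma> F = (THE I. has_line_integral F I \<gamma>)"

lemma has_line_integral_unique:
  assumes "has_line_integral F I \<gamma>" "has_line_integral F J \<gamma>"
  shows "I = J"
proof (rule ccontr)
  assume "I \<noteq> J"
  define e where "e = norm (I - J) / 2"
  have e: "e > 0" using \<open>I \<noteq> J\<close> by (simp add: e_def)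
  define S where "S = (\<lambda>\<D>. \<Sum>(t, K)\<in>\<D>. F (\<gamma> t) * (\<gamma> (Sup K) - \<gamma> (Inf K)))"
  obtain d1 where d1: "d1 > 0"
    "\<And>\<D>. \<D> tagged_division_of {0..1} \<Longrightarrow> (\<forall>(t, K)\<in>\<D>. diameter K < d1) \<Longrightarrow> norm (S \<D> - I) < e"
    using assms(1) e unfolding has_line_integral_def S_def by meson
  obtain d2 where d2: "d2 > 0"
    "\<And>\<D>. \<D> tagged_division_of {0..1} \<Longrightarrow> (\<forall>(t, K)\<in>\<D>. diameter K < d2) \<Longrightarrow> norm (S \<D> - J) < e"
    using assms(2) e unfolding has_line_integral_def S_def by meson
  define d where "d = min d1 d2 / 4"
  have d: "d > 0" "2 * d < d1" "2 * d < d2" using d1(1) d2(1) by (auto simp: d_def)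
  have "gauge (\<lambda>t::real. ball t d)" using d(1) by (simp add: gauge_def)
  then obtain \<D> where D: "\<D> tagged_division_of {0..1}" "(\<lambda>t::real. ball t d) fine \<D>"
    using fine_division_exists_real by blast
  have diam: "diameter K \<le> 2 * d" if "(t, K) \<in> \<D>" for t K
  proof -
    have "K \<subseteq> ball t d" using D(2) that by (auto simp: fine_def)
    then have "diameter K \<le> diameter (ball t d)" by (rule diameter_subset) simp
    also have "\<dots> = 2 * d" using d by simp
    finally show ?thesis .
  qed
  have "norm (S \<D> - I) < e" "norm (S \<D> - J) < e"
    using d1(2)[OF D(1)] d2(2)[OF D(1)] diam d by fastforce+
  then have "norm (I - J) < 2 * e"
    using norm_triangle_ineq4[of "S \<D> - J" "S \<D> - I"] by simp
  then show False by (simp add: e_def)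
qed

lemma line_integral_eqI: "has_line_integral F I \<gamma> \<Longrightarrow> line_integral \<gamma> F = I"
  unfolding line_integral_def by (blast intro: has_line_integral_unique)

definition matrix_line_integral ::
  "(real \<Rightarrow> complex) \<Rightarrow> (complex \<Rightarrow> complex^'m^'n) \<Rightarrow> complex^'m^'n" where
  "matrix_line_integral \<gamma> F = (\<chi> i j. line_integral \<gamma> (\<lambda>z. F z $ i $ j))"

definition spectrum :: "complex^'n^'n \<Rightarrow> complex set" where
  "spectrum A = {z. \<exists>v. v \<noteq> 0 \<and> A *v v = z *s v}"

definition encloses_spectrum ::
  "(real \<Rightarrow> complex) \<Rightarrow> complex set \<Rightarrow> complex set \<Rightarrow> bool" where
  "encloses_spectrum \<Gamma> \<Omega> S \<longleftrightarrow>
     simple_path \<Gamma> \<and> pathfinish \<Gamma> = pathstart \<Gamma> \<and> rectifiable_path \<Gamma> \<and>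
     path_image \<Gamma> \<subseteq> \<Omega> \<and> S \<subseteq> inside (path_image \<Gamma>) \<and> (\<forall>z\<in>S. winding_number \<Gamma> z = 1)"

text \<open>Scalar multiples of complex matrices are written with \<^term>\<open>mat c\<close>, the matrix
  \<open>c\<close> times the identity.\<close>

definition matrix_fun ::
  "(real \<Rightarrow> complex) \<Rightarrow> (complex \<Rightarrow> complex) \<Rightarrow> complex^'n^'n \<Rightarrow> complex^'n^'n" where
  "matrix_fun \<Gamma> h A =
     mat (1 / (2 * of_real pi * \<i>)) **
     matrix_line_integral \<Gamma> (\<lambda>z. mat (h z) ** matrix_inv (mat z - A))"

definition D_op ::
  "(real \<Rightarrow> complex) \<Rightarrow> (complex \<Rightarrow> complex) \<Rightarrow>
   complex^'n^'n \<Rightarrow> complex^'d^'d \<Rightarrow> complex^'d^'n \<Rightarrow> complex^'d^'n" where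
  "D_op \<Gamma> h A B E =
     mat (1 / (2 * of_real pi * \<i>)) **
     matrix_line_integral \<Gamma>
       (\<lambda>z. mat (h z) ** matrix_inv (mat z - A) ** E ** matrix_inv (mat z - B))"

text \<open>The library's \<^const>\<open>has_derivative\<close> only asks for a real-linear map.\<close>

definition is_Frechet_derivative ::
  "(complex^'n^'n \<Rightarrow> complex^'n^'n) \<Rightarrow> complex^'n^'n \<Rightarrow> (complex^'n^'n \<Rightarrow> complex^'n^'n) \<Rightarrow> bool"
  where
  "is_Frechet_derivative F A L \<longleftrightarrow>
     (\<forall>c E. L (mat c ** E) = mat c ** L E) \<and> (F has_derivative L) (at A)"

end

theory Submission
  imports Defs "HOL-Computational_Algebra.Fundamental_Theorem_Algebra"
begin

text \<open>
  Replacing \<open>\<Gamma>\<close> by a nearby valid path, with the same integrals of holomorphic functions, makes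
  Cauchy's theorem available. If \<open>m\<close> annihilates \<open>M\<close> and has all its roots in the spectrum of \<open>M\<close>,
  then Newton's form of the resolvent shows that \<open>h(M) = q(M)\<close> for every polynomial \<open>q\<close> that agrees
  with \<open>h\<close> modulo \<open>m\<close> near the spectrum. The functional calculus is therefore additive,
  multiplicative and compatible with composition and similarity, because these hold for polynomials;
  the contour and the domain play no further role, which is why a second contour may be used for \<open>f \<circ> g\<close>.
  All rules for \<open>\<D>\<^sub>h(A,B,E)\<close> follow by reading off the \<open>(1,2)\<close> block for \<open>M = (A, E; 0, B)\<close>.
  The Frechet derivative comes from the second-order expansion of the resolvent.
\<close>

section \<open>Line integrals along rectifiable paths\<close>

text \<open>Why Newton's form produces a polynomial: its \<open>j\<close>-th term is
  \<open>1 / ((z - x_1) ... (z - x_j))\<close> times \<open>(M - x_1) ... (M - x_{j-1})\<close>, and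
  the Cauchy integral of \<open>h\<close> against the scalar factor is the divided difference of
  \<open>h\<close> at \<open>x_1, ..., x_j\<close>. The whole integral is therefore Newton's
  interpolation polynomial of \<open>h\<close>, evaluated at \<open>M\<close>. Two interpolants of
  one function differ by a multiple of \<open>m\<close>, which vanishes at \<open>M\<close>; this
  replaces the double contour integrals that products and compositions usually call for. Two
  obstacles shape the rest. The contour is merely rectifiable, so Cauchy's theorem has to be carried
  over to Riemann-Stieltjes limits. And \<open>f \<circ> g\<close> is known to be analytic only
  where \<open>g\<close> takes values in \<Omega>, which may exclude parts of \<Gamma>; so
  interpolation is required only on a neighbourhood of the spectrum. The derivative needs its own
  argument because the block identity concerns one matrix at a time, whereas the estimate must be
  uniform over all small perturbations.\<close>

lemma compact_cball_neighbourhood: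
  fixes C U :: "complex set"
  assumes "compact C" "open U" "C \<subseteq> U"
  obtains e where "e > 0" "(\<Union>x\<in>C. cball x e) \<subseteq> U" "compact (\<Union>x\<in>C. cball x e)"
proof -
  obtain e where e: "e > 0" "(\<Union>x\<in>C. cball x e) \<subseteq> U"
    using compact_subset_open_imp_cball_epsilon_subset[OF assms] by blast
  \<comment> \<open>The union of balls is the Minkowski sum of \<open>C\<close> and a closed ball,
    hence compact.\<close>
  have "(\<Union>x\<in>C. cball x e) = (\<Union>x\<in>C. \<Union>y\<in>cball 0 e. {x + y})"
  proof (intro SUP_cong refl)
    fix x :: complex show "cball x e = (\<Union>y\<in>cball 0 e. {x + y})"
      by (force simp: dist_norm norm_minus_commute intro: bexI[of _ "_ - x"])
  qed
  moreover have "compact \<dots>"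
    using compact_sums'[OF assms(1) compact_cball] .
  ultimately show ?thesis using e that by simp
qed

text \<open>Uniform continuity on a compact neighbourhood of \<open>C\<close> rather than on
  \<open>C\<close>: the point \<open>y\<close> may leave \<open>C\<close>, as it will range over a
  disc around a point of the path.\<close>

lemma uniformly_close_near_compact:
  fixes C U :: "complex set" and F :: "complex \<Rightarrow> complex"
  assumes "compact C" "open U" "C \<subseteq> U" "continuous_on U F" "\<eta> > 0"
  obtains d where "d > 0" "\<And>x y. x \<in> C \<Longrightarrow> dist x y < d \<Longrightarrow> y \<in> U \<and> dist (F y) (F x) < \<eta>"
proof -
  obtain e where e: "e > 0" "(\<Union>x\<in>C. cball x e) \<subseteq> U" "compact (\<Union>x\<in>C. cball x e)"
    using compact_cball_neighbourhood[OF assms(1-3)] .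
  have "uniformly_continuous_on (\<Union>x\<in>C. cball x e) F"
    using e assms(4) by (intro compact_uniformly_continuous) (auto intro: continuous_on_subset)
  then obtain d where d: "d > 0"
    "\<And>x y. \<lbrakk>x \<in> (\<Union>x\<in>C. cball x e); y \<in> (\<Union>x\<in>C. cball x e); dist y x < d\<rbrakk> \<Longrightarrow> dist (F y) (F x) < \<eta>"
    using \<open>\<eta> > 0\<close> unfolding uniformly_continuous_on_def by meson
  show ?thesis
  proof (rule that[of "min d e"])
    show "min d e > 0" using d e by simp
    fix x y assume "x \<in> C" "dist x y < min d e"
    then have "x \<in> (\<Union>x\<in>C. cball x e)" "y \<in> (\<Union>x\<in>C. cball x e)" "dist y x < d"
      using e(1) by (force simp: dist_commute)+
    then show "y \<in> U \<and> dist (F y) (F x) < \<eta>" using d e by blast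
  qed
qed

text \<open>The increments of \<Phi> telescope over a division, and the local errors add up to at
  most \<eta> times the variation of \<gamma>. This is where rectifiability enters.\<close>

lemma has_line_integral_by_increments:
  assumes rect: "rectifiable_path \<gamma>"
    and inc: "\<And>\<eta>. \<eta> > 0 \<Longrightarrow> \<exists>\<delta>>0. \<forall>a b t. 0 \<le> a \<and> a \<le> t \<and> t \<le> b \<and> b \<le> 1 \<and> b - a < \<delta> \<longrightarrow>
        norm (F (\<gamma> t) * (\<gamma> b - \<gamma> a) - (\<Phi> b - \<Phi> a)) \<le> \<eta> * norm (\<gamma> b - \<gamma> a)"
  shows "has_line_integral F (\<Phi> 1 - \<Phi> 0) \<gamma>"
  unfolding has_line_integral_def
proof (intro allI impI)
  fix e :: real assume "e > 0"
  obtain L where L: "\<And>\<D>. \<D> division_of {0..1} \<Longrightarrow> (\<Sum>K\<in>\<D>. norm (\<gamma> (Sup K) - \<gamma> (Inf K))) \<le> L"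
    using rect unfolding rectifiable_path_def by blast
  \<comment> \<open>The bound \<open>L\<close> comes without a sign, and the final inequality is
    strict; the absolute value and the summand 1 take care of both.\<close>
  define \<eta> where "\<eta> = e / (\<bar>L\<bar> + 1)"
  have \<eta>: "\<eta> > 0" "\<eta> * L < e"
  proof -
    show "\<eta> > 0" using \<open>e > 0\<close> by (simp add: \<eta>_def)
    have "\<eta> * L \<le> \<eta> * \<bar>L\<bar>" using \<open>\<eta> > 0\<close> by (intro mult_left_mono) auto
    also have "\<dots> < \<eta> * (\<bar>L\<bar> + 1)" using \<open>\<eta> > 0\<close> by simp
    also have "\<dots> = e" by (simp add: \<eta>_def)
    finally show "\<eta> * L < e" .
  qed
  obtain \<delta> where \<delta>: "\<delta> > 0" "\<And>a b t. \<lbrakk>0 \<le> a; a \<le> t; t \<le> b; b \<le> 1; b - a < \<delta>\<rbrakk> \<Longrightarrow>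
        norm (F (\<gamma> t) * (\<gamma> b - \<gamma> a) - (\<Phi> b - \<Phi> a)) \<le> \<eta> * norm (\<gamma> b - \<gamma> a)"
    using inc[OF \<eta>(1)] by blast
  show "\<exists>\<delta>>0. \<forall>\<D>. \<D> tagged_division_of {0..1} \<and> (\<forall>(t, K)\<in>\<D>. diameter K < \<delta>) \<longrightarrow>
        norm ((\<Sum>(t, K)\<in>\<D>. F (\<gamma> t) * (\<gamma> (Sup K) - \<gamma> (Inf K))) - (\<Phi> 1 - \<Phi> 0)) < e"
  proof (intro exI conjI allI impI)
    show "\<delta> > 0" by fact
    fix \<D> :: "(real \<times> real set) set" assume D: "\<D> tagged_division_of {0..1} \<and> (\<forall>(t, K)\<in>\<D>. diameter K < \<delta>)"
    then have td: "\<D> tagged_division_of {0..1}" by blast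
    have each: "norm (F (\<gamma> t) * (\<gamma> (Sup K) - \<gamma> (Inf K)) - (\<Phi> (Sup K) - \<Phi> (Inf K)))
          \<le> \<eta> * norm (\<gamma> (Sup K) - \<gamma> (Inf K))" if "(t, K) \<in> \<D>" for t :: real and K
    proof -
      obtain a b :: real where K: "K = {a..b}" and t: "t \<in> K" and "K \<subseteq> {0..1}"
        using tagged_division_ofD(2-4)[OF td \<open>(t, K) \<in> \<D>\<close>] by (metis interval_cbox)
      then have "a \<le> b" "0 \<le> a" "b \<le> 1" by auto
      moreover have "diameter K < \<delta>" using D that by auto
      ultimately show ?thesis using \<delta>(2)[of a t b] K t by auto
    qed
    have "(\<Sum>(t, K)\<in>\<D>. \<Phi> (Sup K) - \<Phi> (Inf K)) = \<Phi> 1 - \<Phi> 0"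
      using additive_tagged_division_1[OF _ td] by simp
    then have "(\<Sum>(t, K)\<in>\<D>. F (\<gamma> t) * (\<gamma> (Sup K) - \<gamma> (Inf K))) - (\<Phi> 1 - \<Phi> 0)
       = (\<Sum>(t, K)\<in>\<D>. F (\<gamma> t) * (\<gamma> (Sup K) - \<gamma> (Inf K)) - (\<Phi> (Sup K) - \<Phi> (Inf K)))"
      by (metis (mono_tags, lifting) case_prod_beta' sum.cong sum_subtractf)
    also have "norm \<dots> \<le> (\<Sum>(t, K)\<in>\<D>. \<eta> * norm (\<gamma> (Sup K) - \<gamma> (Inf K)))"
      using each by (intro sum_norm_le) auto
    \<comment> \<open>The variation is a sum over intervals without tags. Dropping the tags requires
      a summand that vanishes on every interval with empty interior; on the empty set
      \<open>Sup\<close> and \<open>Inf\<close> give no usable value, so 0 is inserted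
      there.\<close>
    also have "\<dots> = (\<Sum>(t, K)\<in>\<D>. if K = {} then 0 else \<eta> * norm (\<gamma> (Sup K) - \<gamma> (Inf K)))"
      by (intro sum.cong) (auto dest: tagged_division_ofD(2)[OF td])
    also have "\<dots> = (\<Sum>K\<in>snd ` \<D>. if K = {} then 0 else \<eta> * norm (\<gamma> (Sup K) - \<gamma> (Inf K)))"
    proof (rule sum.over_tagged_division_lemma[OF td])
      fix u v :: real assume "box u v = {}"
      then have "cbox u v = {} \<or> u = v" by auto
      then show "(if cbox u v = {} then 0
          else \<eta> * norm (\<gamma> (Sup (cbox u v)) - \<gamma> (Inf (cbox u v)))) = 0" by auto
    qed
    also have "\<dots> \<le> (\<Sum>K\<in>snd ` \<D>. \<eta> * norm (\<gamma> (Sup K) - \<gamma> (Inf K)))"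
      using \<eta>(1) by (intro sum_mono) auto
    also have "\<dots> \<le> \<eta> * L"
      using L[OF division_of_tagged_division[OF td]] \<eta>(1)
      by (simp add: sum_distrib_left[symmetric] mult_left_mono)
    also have "\<dots> < e" by fact
    finally show "norm ((\<Sum>(t, K)\<in>\<D>. F (\<gamma> t) * (\<gamma> (Sup K) - \<gamma> (Inf K))) - (\<Phi> 1 - \<Phi> 0)) < e" .
  qed
qed

lemma has_line_integral_zero: "has_line_integral (\<lambda>z. 0) 0 \<gamma>"
  unfolding has_line_integral_def by (auto intro!: exI[of _ 1])

lemma line_integral_zero [simp]: "line_integral \<gamma> (\<lambda>z. 0) = 0"
  by (rule line_integral_eqI[OF has_line_integral_zero])

lemma line_integral_cong:
  assumes "\<And>z. z \<in> path_image \<gamma> \<Longrightarrow> F z = G z"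
  shows "line_integral \<gamma> F = line_integral \<gamma> G"
proof -
  have "(\<Sum>(t, K)\<in>\<D>. F (\<gamma> t) * (\<gamma> (Sup K) - \<gamma> (Inf K))) =
        (\<Sum>(t, K)\<in>\<D>. G (\<gamma> t) * (\<gamma> (Sup K) - \<gamma> (Inf K)))"
    if "\<D> tagged_division_of {0..1}" for \<D>
  proof (intro sum.cong refl, clarify)
    fix t K assume "(t, K) \<in> \<D>"
    then have "\<gamma> t \<in> path_image \<gamma>"
      using tagged_division_ofD(2,3)[OF that] unfolding path_image_def by blast
    then show "F (\<gamma> t) * (\<gamma> (Sup K) - \<gamma> (Inf K)) = G (\<gamma> t) * (\<gamma> (Sup K) - \<gamma> (Inf K))"
      using assms by simp
  qed
  then show ?thesis
    unfolding line_integral_def has_line_integral_def by (simp cong: conj_cong)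
qed

text \<open>The mean value inequality for \<open>P z - c * z\<close>, whose derivative
  \<open>F z - c\<close> is bounded by \<eta> on the convex set.\<close>

lemma increments_of_local_primitive:
  fixes P F :: "complex \<Rightarrow> complex"
  assumes "convex S" "\<And>z. z \<in> S \<Longrightarrow> (P has_field_derivative F z) (at z within S)"
    and "\<And>z. z \<in> S \<Longrightarrow> norm (F z - c) \<le> \<eta>" "x \<in> S" "y \<in> S"
  shows "norm (c * (y - x) - (P y - P x)) \<le> \<eta> * norm (y - x)"
proof -
  have "norm ((P y - c * y) - (P x - c * x)) \<le> \<eta> * norm (y - x)"
    by (rule field_differentiable_bound[OF assms(1), where f' = "\<lambda>z. F z - c"])
      (use assms in \<open>auto intro!: derivative_eq_intros\<close>)
  then show ?thesis by (subst norm_minus_commute) (simp add: algebra_simps)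
qed

text \<open>With \<open>p\<close> uniformly close to \<open>\<gamma>\<close>, going along \<open>p\<close> up to time \<open>t\<close> and then straight to
  \<open>\<gamma> t\<close> yields a function \<open>\<Phi>\<close> whose short increments are those of a local primitive along \<open>\<gamma>\<close>.\<close>

lemma valid_path_approximation:
  assumes rect: "rectifiable_path \<gamma>" and U: "open U" "path_image \<gamma> \<subseteq> U"
  obtains p where "valid_path p" "path_image p \<subseteq> U"
    "pathstart p = pathstart \<gamma>" "pathfinish p = pathfinish \<gamma>"
    "\<And>w. w \<notin> U \<Longrightarrow> winding_number p w = winding_number \<gamma> w"
    "\<And>F. F holomorphic_on U \<Longrightarrow> has_line_integral F (contour_integral p F) \<gamma>"
proof -
  have "path \<gamma>" using rect unfolding rectifiable_path_def by blast
  obtain e where e: "e > 0" "(\<Union>x\<in>path_image \<gamma>. ball x e) \<subseteq> U"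
    using compact_subset_open_imp_ball_epsilon_subset[OF compact_path_image[OF \<open>path \<gamma>\<close>] U] by blast
  have ball_U: "ball (\<gamma> t) e \<subseteq> U" if "t \<in> {0..1}" for t
    using e(2) that unfolding path_image_def by blast
  \<comment> \<open>Half of the radius \<open>e\<close> is kept for the movement of \<open>p\<close>
    during a short time, so that \<open>p s\<close> remains in the disc around
    \<open>\<gamma> a\<close> for \<open>s\<close> near \<open>a\<close>.\<close>
  obtain p where poly: "polynomial_function p" and ends: "pathstart p = pathstart \<gamma>" "pathfinish p = pathfinish \<gamma>"
    and close: "\<And>t. t \<in> {0..1} \<Longrightarrow> norm (p t - \<gamma> t) < e / 2"
    using path_approx_polynomial_function[OF \<open>path \<gamma>\<close>, of "e / 2"] e(1) by auto
  have vp: "valid_path p" by (rule valid_path_polynomial_function[OF poly])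
  have p_ball: "p t \<in> ball (\<gamma> t) e" if "t \<in> {0..1}" for t
    using close[OF that] e(1) by (simp add: dist_norm norm_minus_commute)
  have p_U: "path_image p \<subseteq> U"
    using p_ball ball_U unfolding path_image_def by blast
  show thesis
  proof (rule that[OF vp p_U ends])
    fix w assume "w \<notin> U"
    have "homotopic_paths U p \<gamma>"
    proof (rule homotopic_paths_linear)
      fix t :: real assume t: "t \<in> {0..1}"
      have "closed_segment (p t) (\<gamma> t) \<subseteq> ball (\<gamma> t) e"
        using p_ball[OF t] e(1) by (intro closed_segment_subset) auto
      then show "closed_segment (p t) (\<gamma> t) \<subseteq> U" using ball_U[OF t] by blast
    qed (use vp \<open>path \<gamma>\<close> ends valid_path_imp_path in auto)
    then have "homotopic_paths (- {w}) p \<gamma>"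
      by (rule homotopic_paths_subset) (use \<open>w \<notin> U\<close> in auto)
    then show "winding_number p w = winding_number \<gamma> w" by (rule winding_number_homotopic_paths)
  next
    fix F assume F: "F holomorphic_on U"
    \<comment> \<open>\<open>F\<close> may lack a primitive on \<open>U\<close>; \<Phi> is a
      primitive continued along the path, which is all that the increments need.\<close>
    define \<Phi> where "\<Phi> t = contour_integral (subpath 0 t p) F + contour_integral (linepath (p t) (\<gamma> t)) F" for t
    have ints: "F contour_integrable_on p"
      by (rule contour_integrable_holomorphic_simple[OF F U(1) vp p_U])
    have "has_line_integral F (\<Phi> 1 - \<Phi> 0) \<gamma>"
    proof (rule has_line_integral_by_increments[OF rect])
      fix \<eta> :: real assume "\<eta> > 0"
      obtain d where d: "d > 0"
        "\<And>x y. x \<in> path_image \<gamma> \<Longrightarrow> dist x y < d \<Longrightarrow> y \<in> U \<and> dist (F y) (F x) < \<eta>"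
        using uniformly_close_near_compact[OF compact_path_image[OF \<open>path \<gamma>\<close>] U
            holomorphic_on_imp_continuous_on[OF F] \<open>\<eta> > 0\<close>] by metis
      have "uniformly_continuous_on {0..1} \<gamma>" "uniformly_continuous_on {0..1} p"
        using \<open>path \<gamma>\<close> valid_path_imp_path[OF vp]
        by (auto simp: path_def intro: compact_uniformly_continuous)
      then obtain d1 d2 where d1: "d1 > 0" "\<And>s t. \<lbrakk>s \<in> {0..1}; t \<in> {0..1}; dist t s < d1\<rbrakk> \<Longrightarrow> dist (\<gamma> t) (\<gamma> s) < min d e"
        and d2: "d2 > 0" "\<And>s t. \<lbrakk>s \<in> {0..1}; t \<in> {0..1}; dist t s < d2\<rbrakk> \<Longrightarrow> dist (p t) (p s) < e / 2"
        unfolding uniformly_continuous_on_def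
        using d(1) e(1) by (metis min_less_iff_conj half_gt_zero)
      have "norm (F (\<gamma> t) * (\<gamma> b - \<gamma> a) - (\<Phi> b - \<Phi> a)) \<le> \<eta> * norm (\<gamma> b - \<gamma> a)"
        if "0 \<le> a" "a \<le> t" "t \<le> b" "b \<le> 1" and ba: "b - a < min d1 d2" for a b t
      proof -
        have ab: "a \<in> {0..1}" "b \<in> {0..1}" "t \<in> {0..1}" using that by auto
        obtain P where P: "\<And>z. z \<in> ball (\<gamma> a) e \<Longrightarrow> (P has_field_derivative F z) (at z within ball (\<gamma> a) e)"
          using holomorphic_convex_primitive'[OF convex_ball open_ball, of F "\<gamma> a" e]
            holomorphic_on_subset[OF F ball_U[OF ab(1)]] by blast
        have p_near: "p s \<in> ball (\<gamma> a) e" if "s \<in> {a..b}" for s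
        proof -
          have "dist (p s) (p a) < e / 2" using d2(2)[of a s] that ba ab by (auto simp: dist_real_def)
          moreover have "dist (p a) (\<gamma> a) < e / 2" using close[OF ab(1)] by (simp add: dist_norm)
          ultimately show ?thesis
            using dist_triangle[of "p s" "\<gamma> a" "p a"] by (simp add: dist_commute)
        qed
        have \<gamma>_near: "\<gamma> b \<in> ball (\<gamma> a) e" "\<gamma> a \<in> ball (\<gamma> a) e"
          using d1(2)[of a b] that ab e(1) by (auto simp: dist_real_def dist_commute)
        have sub: "contour_integral (subpath a b p) F = P (p b) - P (p a)"
        proof -
          have "path_image (subpath a b p) \<subseteq> ball (\<gamma> a) e"
            using p_near that by (auto simp: path_image_subpath)
          from contour_integral_primitive[OF P valid_path_subpath[OF vp ab(1,2)] this]
          show ?thesis by (simp add: contour_integral_unique)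
        qed
        have lin: "contour_integral (linepath x y) F = P y - P x"
          if "x \<in> ball (\<gamma> a) e" "y \<in> ball (\<gamma> a) e" for x y
        proof -
          have "path_image (linepath x y) \<subseteq> ball (\<gamma> a) e"
            unfolding path_image_linepath using that by (intro closed_segment_subset) auto
          from contour_integral_primitive[OF P valid_path_linepath this]
          show ?thesis by (simp add: contour_integral_unique)
        qed
        have "contour_integral (subpath 0 a p) F + contour_integral (subpath a b p) F
            = contour_integral (subpath 0 b p) F"
          by (rule contour_integral_subpath_combine[OF ints vp]) (use ab in auto)
        moreover have "contour_integral (linepath (p a) (\<gamma> a)) F = P (\<gamma> a) - P (p a)"
          "contour_integral (linepath (p b) (\<gamma> b)) F = P (\<gamma> b) - P (p b)"
          using that by (intro lin p_near \<gamma>_near; simp)+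
        \<comment> \<open>The values of \<open>P\<close> at \<open>p a\<close> and
          \<open>p b\<close> cancel, and only the endpoints on \<gamma> remain.\<close>
        ultimately have \<Phi>: "\<Phi> b - \<Phi> a = P (\<gamma> b) - P (\<gamma> a)"
          unfolding \<Phi>_def sub by (metis (no_types, opaque_lifting) add.commute add_diff_cancel_left diff_add_eq diff_diff_eq2 eq_iff_diff_eq_0)
        \<comment> \<open>The first disc carries the primitive \<open>P\<close>; on the second,
          \<open>F\<close> stays within \<eta> of its value at the tag. The intersection is convex
          and contains both endpoints.\<close>
        define S where "S = ball (\<gamma> a) e \<inter> ball (\<gamma> t) d"
        have "\<gamma> t \<in> path_image \<gamma>" using ab by (auto simp: path_image_def)
        then have "norm (F z - F (\<gamma> t)) \<le> \<eta>" if "z \<in> S" for z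
          using d(2)[of "\<gamma> t" z] that by (auto simp: S_def dist_norm)
        moreover have "\<gamma> a \<in> S" "\<gamma> b \<in> S"
          using \<gamma>_near d1(2)[of t a] d1(2)[of t b] that ab
          by (auto simp: S_def dist_real_def dist_commute)
        moreover have "(P has_field_derivative F z) (at z within S)" if "z \<in> S" for z
          by (rule DERIV_subset[OF P]) (use that in \<open>auto simp: S_def\<close>)
        ultimately show ?thesis
          unfolding \<Phi> by (intro increments_of_local_primitive[of S]) (auto simp: S_def convex_Int)
      qed
      then show "\<exists>\<delta>>0. \<forall>a b t. 0 \<le> a \<and> a \<le> t \<and> t \<le> b \<and> b \<le> 1 \<and> b - a < \<delta> \<longrightarrow>
        norm (F (\<gamma> t) * (\<gamma> b - \<gamma> a) - (\<Phi> b - \<Phi> a)) \<le> \<eta> * norm (\<gamma> b - \<gamma> a)"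
        using d1(1) d2(1) by (intro exI[of _ "min d1 d2"]) auto
    qed
    \<comment> \<open>At times 0 and 1 the connecting segment is a point, because \<open>p\<close>
      and \<gamma> have the same endpoints.\<close>
    moreover have "\<Phi> 0 = 0" "\<Phi> 1 = contour_integral p F"
      using ends by (simp_all add: \<Phi>_def pathstart_def pathfinish_def)
    ultimately show "has_line_integral F (contour_integral p F) \<gamma>" by simp
  qed
qed

section \<open>Polynomials of a matrix\<close>

text \<open>This notation, left over from the formal power series theories, clashes with vector indexing.\<close>

no_notation fps_nth (infixl "$" 75)

section \<open>Matrix algebra with scalar matrices\<close>

lemma matrix_mul_zero [simp]:
  "(0 :: 'a::semiring_1^'n^'m) ** (A :: 'a^'k^'n) = 0" "(B :: 'a^'n^'m) ** (0 :: 'a^'k^'n) = 0"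
  by (simp_all add: matrix_matrix_mult_def vec_eq_iff)

lemma matrix_diff_ldistrib:
  fixes A :: "'a::ring_1^'n^'m" and B C :: "'a^'k^'n"
  shows "A ** (B - C) = A ** B - A ** C"
  by (vector matrix_matrix_mult_def sum_subtractf right_diff_distrib)

lemma matrix_diff_rdistrib:
  fixes A :: "'a::ring_1^'k^'n" and B C :: "'a^'n^'m"
  shows "(B - C) ** A = B ** A - C ** A"
  by (vector matrix_matrix_mult_def sum_subtractf left_diff_distrib)

lemma matrix_add_rdistrib:
  fixes A :: "'a::semiring_1^'k^'n" and B C :: "'a^'n^'m"
  shows "(B + C) ** A = B ** A + C ** A"
  by (vector matrix_matrix_mult_def sum.distrib distrib_right)

lemma mat_zero [simp]: "mat 0 = 0"
  by (simp add: mat_def vec_eq_iff)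

lemma mat_add: "mat (a + b) = mat a + mat (b :: 'a::monoid_add)"
  by (simp add: mat_def vec_eq_iff)

lemma mat_diff: "mat (a - b) = mat a - mat (b :: 'a::group_add)"
  by (simp add: mat_def vec_eq_iff)

lemma mat_mul_component [simp]: "(mat c ** (A :: 'a::semiring_1^'n^'m)) $ i $ j = c * A $ i $ j"
  by (simp add: matrix_matrix_mult_def mat_def if_distrib if_distribR cong: if_cong)

lemma mul_mat_component [simp]: "((A :: 'a::semiring_1^'n^'m) ** mat c) $ i $ j = A $ i $ j * c"
  by (simp add: matrix_matrix_mult_def mat_def if_distrib if_distribR cong: if_cong)

lemma mat_mul_commute: "(A :: 'a::comm_semiring_1^'n^'m) ** mat c = mat c ** A"
  by (simp add: vec_eq_iff mult.commute)

lemma mat_mul_mat: "mat a ** mat b = mat (a * b :: 'a::semiring_1)"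
  by (simp add: vec_eq_iff) (simp add: mat_def)

lemma mat_mul_left_commute:
  "(A :: 'a::comm_semiring_1^'n^'m) ** (mat c ** (B :: 'a^'k^'n)) = mat c ** (A ** B)"
  by (simp add: matrix_mul_assoc mat_mul_commute[of A])

lemma mat_mul_vector [simp]: "mat c *v v = c *s (v :: 'a::semiring_1^'n)"
  by (simp add: vec_eq_iff matrix_vector_mult_def mat_def if_distrib if_distribR cong: if_cong)

lemma matrix_vector_mul_smult: "(A :: 'a::comm_semiring_1^'n^'m) *v (c *s v) = c *s (A *v v)"
  by (simp add: vec_eq_iff matrix_vector_mult_def sum_distrib_left mult.left_commute)

text \<open>For square matrices over a field a one-sided inverse is two-sided, so the choice
  operator in \<open>matrix_inv\<close> has exactly one candidate.\<close>

lemma matrix_inv_unique: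
  fixes A B :: "'a::field^'n^'n"
  assumes "A ** B = mat 1"
  shows "matrix_inv A = B"
proof -
  have BA: "B ** A = mat 1" using assms matrix_left_right_inverse by blast
  have "A ** matrix_inv A = mat 1 \<and> matrix_inv A ** A = mat 1"
    unfolding matrix_inv_def by (rule someI[of _ B]) (use assms BA in simp)
  then have "matrix_inv A = (B ** A) ** matrix_inv A" using BA by simp
  also have "\<dots> = B"
    using \<open>A ** matrix_inv A = mat 1 \<and> _\<close> by (simp add: matrix_mul_assoc[symmetric])
  finally show ?thesis .
qed

lemma matrix_inv_right: "invertible A \<Longrightarrow> A ** matrix_inv A = mat 1"
  and matrix_inv_left: "invertible A \<Longrightarrow> matrix_inv A ** A = mat 1"
  for A :: "'a::field^'n^'n"
  unfolding invertible_def using matrix_inv_unique by metis+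

section \<open>Evaluation of polynomials at a matrix\<close>

definition poly_mat :: "'a::comm_ring_1 poly \<Rightarrow> 'a^'n^'n \<Rightarrow> 'a^'n^'n" where
  "poly_mat p M = fold_coeffs (\<lambda>a X. mat a + M ** X) p 0"

lemma poly_mat_0 [simp]: "poly_mat 0 M = 0"
  by (simp add: poly_mat_def)

lemma poly_mat_pCons [simp]: "poly_mat (pCons a p) M = mat a + M ** poly_mat p M"
  by (cases "p = 0 \<and> a = 0") (auto simp: poly_mat_def)

lemma poly_mat_1 [simp]: "poly_mat 1 M = mat 1"
  by (simp add: one_pCons)

lemma poly_mat_add: "poly_mat (p + q) M = poly_mat p M + poly_mat q M"
  by (induction p q rule: poly_induct2) (simp_all add: mat_add matrix_add_ldistrib)

lemma poly_mat_diff: "poly_mat (p - q) M = poly_mat p M - poly_mat q M"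
  by (induction p q rule: poly_induct2) (simp_all add: mat_diff matrix_diff_ldistrib)

lemma poly_mat_sum: "poly_mat (\<Sum>i\<in>I. p i) M = (\<Sum>i\<in>I. poly_mat (p i) M)"
  by (induction I rule: infinite_finite_induct) (simp_all add: poly_mat_add)

lemma poly_mat_smult: "poly_mat (smult c p) M = mat c ** poly_mat p M"
  by (induction p)
    (simp_all add: matrix_add_ldistrib mat_mul_left_commute[of M] mat_mul_mat)

lemma poly_mat_mult: "poly_mat (p * q) M = poly_mat p M ** poly_mat q M"
  by (induction p)
    (simp_all add: poly_mat_add poly_mat_smult matrix_add_rdistrib matrix_mul_assoc)

lemma poly_mat_commute: "poly_mat p M ** poly_mat q M = poly_mat q M ** poly_mat p M"
  by (simp add: poly_mat_mult[symmetric] mult.commute)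

lemma poly_mat_pcompose: "poly_mat (pcompose p q) M = poly_mat p (poly_mat q M)"
  by (induction p) (simp_all add: pcompose_pCons poly_mat_add poly_mat_mult)

lemma poly_mat_linear: "poly_mat [:- a, 1:] M = M - mat a"
  using mat_diff[of 0 a] by simp

lemma poly_mat_eigenvector:
  assumes "M *v v = z *s v"
  shows "poly_mat p M *v v = poly p z *s v"
proof (induction p)
  case (pCons a p)
  then show ?case
    using assms by (simp add: matrix_vector_mult_add_rdistrib matrix_vector_mul_assoc[symmetric]
        matrix_vector_mul_smult vector_sadd_rdistrib mult.commute)
qed simp

lemma poly_mat_similar:
  assumes "P ** Q = mat 1" "Q ** P = mat 1"
  shows "poly_mat p (P ** M ** Q) = P ** poly_mat p M ** Q"
proof (induction p)
  case (pCons a p)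
  have "(P ** M ** Q) ** (P ** poly_mat p M ** Q) = P ** M ** (Q ** P) ** poly_mat p M ** Q"
    by (simp only: matrix_mul_assoc)
  moreover have "P ** mat a ** Q = mat a"
    using assms(1) by (simp add: mat_mul_commute[of P] matrix_mul_assoc[symmetric])
  ultimately show ?case
    using pCons.IH assms(2) by (simp add: matrix_add_ldistrib matrix_add_rdistrib matrix_mul_assoc)
qed simp

section \<open>Annihilating polynomials with roots in the spectrum\<close>

lemma mat_of_real_mul: "mat (of_real r) ** (A :: complex^'n^'m) = r *\<^sub>R A"
  by (simp add: vec_eq_iff scaleR_conv_of_real[where 'a = complex])

text \<open>There are more powers of \<open>M\<close> up to exponent \<open>n\<close> than the real
  dimension of the matrix space, so they are dependent already over the reals. Dependence is a
  property of sets, hence coinciding powers are treated separately.\<close>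

lemma exists_annihilating_poly:
  fixes M :: "complex^'n^'n"
  obtains p where "p \<noteq> 0" "poly_mat p M = 0"
proof -
  define n where "n = DIM(complex^'n^'n)"
  define pow where "pow i = poly_mat (monom 1 i) M" for i
  show ?thesis
  proof (cases "inj_on pow {..n}")
    case False
    then obtain i j where "i \<noteq> j" "pow i = pow j" by (auto simp: inj_on_def)
    moreover from \<open>i \<noteq> j\<close> have "monom 1 i \<noteq> (monom 1 j :: complex poly)"
      by (simp add: monom_eq_iff')
    ultimately show ?thesis
      by (intro that[of "monom 1 i - monom 1 j"]) (simp_all add: poly_mat_diff pow_def)
  next
    case True
    then have "card (pow ` {..n}) > DIM(complex^'n^'n)" by (simp add: card_image n_def)
    then have "dependent (pow ` {..n})" by (intro dependent_biggerset)
    then obtain u where u: "\<exists>i\<le>n. u (pow i) \<noteq> 0" "(\<Sum>v\<in>pow ` {..n}. u v *\<^sub>R v) = 0"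
      by (auto simp: dependent_finite)
    define p where "p = (\<Sum>i\<le>n. monom (complex_of_real (u (pow i))) i)"
    have "coeff p i = u (pow i)" if "i \<le> n" for i
      using that by (simp add: p_def coeff_sum if_distrib cong: if_cong)
    then have "p \<noteq> 0" using u(1) by force
    moreover have "poly_mat p M = (\<Sum>i\<le>n. u (pow i) *\<^sub>R pow i)"
      unfolding p_def poly_mat_sum pow_def mat_of_real_mul[symmetric] poly_mat_smult[symmetric]
      by (simp add: smult_monom)
    then have "poly_mat p M = 0" using u(2) True by (simp add: sum.reindex)
    ultimately show ?thesis by (rule that)
  qed
qed

text \<open>Roots are kept in a list because repetitions encode multiplicities and the recursions
  below peel off one root at a time.\<close>

definition root_poly :: "'a::comm_ring_1 list \<Rightarrow> 'a poly" where
  "root_poly xs = (\<Prod>x\<leftarrow>xs. [:- x, 1:])"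

lemma root_poly_simps [simp]:
  "root_poly [] = 1" "root_poly (x # xs) = [:- x, 1:] * root_poly xs"
  by (simp_all add: root_poly_def)

lemma poly_root_poly_eq_0 [simp]: "poly (root_poly xs) z = 0 \<longleftrightarrow> z \<in> set xs" for z :: "'a::idom"
  by (induction xs) auto

lemma left_inverse_of_notin_spectrum:
  assumes "a \<notin> spectrum M"
  obtains B where "B ** (M - mat a) = mat 1"
proof -
  have "v = 0" if "(M - mat a) *v v = 0" for v
    using assms that unfolding spectrum_def by (auto simp: matrix_vector_mult_diff_rdistrib)
  then show ?thesis using matrix_left_invertible_ker[of "M - mat a"] that by blast
qed

text \<open>The factor \<open>Y\<close> makes the induction go through. A linear factor of
  \<open>p\<close> with root in the spectrum is moved into \<open>Y\<close> and recorded in the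
  list; for any other root \<open>a\<close> the matrix \<open>M - mat a\<close> is invertible and
  its factor is cancelled.\<close>

lemma annihilating_roots_aux:
  fixes M Y :: "complex^'n^'n"
  assumes "p \<noteq> 0" "poly_mat p M ** Y = 0"
  shows "\<exists>xs. set xs \<subseteq> spectrum M \<and> poly_mat (root_poly xs) M ** Y = 0"
  using assms
proof (induction "degree p" arbitrary: p Y)
  case 0
  then obtain c where "p = [:c:]" "c \<noteq> 0" using degree_0_id by (metis pCons_eq_0_iff)
  then have "Y = 0" using 0 by (simp add: vec_eq_iff)
  then show ?case by (intro exI[of _ "[]"]) simp
next
  case (Suc n)
  then have "\<not> constant (poly p)" by (simp add: constant_degree)
  then obtain a where "poly p a = 0" using fundamental_theorem_of_algebra by blast
  then obtain q where p: "p = [:- a, 1:] * q" by (auto simp: poly_eq_0_iff_dvd)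
  then have q: "q \<noteq> 0" "n = degree q" using Suc.prems(1) Suc.hyps(2) by (auto simp: degree_mult_eq simp del: mult_pCons_left)
  have MaY: "(M - mat a) ** (poly_mat q M ** Y) = 0"
    using Suc.prems(2) unfolding p poly_mat_mult poly_mat_linear by (simp add: matrix_mul_assoc)
  show ?case
  proof (cases "a \<in> spectrum M")
    case True
    have "poly_mat q M ** ((M - mat a) ** Y) = 0"
      using MaY poly_mat_commute[of q M "[:- a, 1:]"]
      unfolding poly_mat_linear by (simp add: matrix_mul_assoc)
    from Suc.hyps(1)[OF q(2,1) this] obtain xs where xs: "set xs \<subseteq> spectrum M"
      "poly_mat (root_poly xs) M ** ((M - mat a) ** Y) = 0" by blast
    have "poly_mat (root_poly (a # xs)) M ** Y = 0"
      using xs(2) poly_mat_commute[of "root_poly xs" M "[:- a, 1:]"]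
      unfolding root_poly_simps poly_mat_mult poly_mat_linear by (simp add: matrix_mul_assoc)
    then show ?thesis using True xs(1) by (intro exI[of _ "a # xs"]) simp
  next
    case False
    then obtain B where B: "B ** (M - mat a) = mat 1" by (rule left_inverse_of_notin_spectrum)
    have "poly_mat q M ** Y = B ** ((M - mat a) ** (poly_mat q M ** Y))"
      using B by (simp add: matrix_mul_assoc)
    then have "poly_mat q M ** Y = 0" using MaY by simp
    from Suc.hyps(1)[OF q(2,1) this] show ?thesis .
  qed
qed

lemma spectrum_subset_roots:
  assumes "poly_mat p M = 0" "z \<in> spectrum M"
  shows "poly p z = 0"
proof -
  obtain v where "v \<noteq> 0" "M *v v = z *s v" using assms(2) unfolding spectrum_def by blast
  then show ?thesis using poly_mat_eigenvector[of M v z p] assms(1) by (auto simp: vec_eq_iff)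
qed

lemma annihilating_roots:
  fixes M :: "complex^'n^'n"
  obtains xs where "set xs = spectrum M" "xs \<noteq> []" "poly_mat (root_poly xs) M = 0"
proof -
  obtain p where "p \<noteq> 0" "poly_mat p M = 0" by (rule exists_annihilating_poly)
  then obtain xs where xs: "set xs \<subseteq> spectrum M" "poly_mat (root_poly xs) M = 0"
    using annihilating_roots_aux[of p M "mat 1"] by auto
  moreover have "spectrum M \<subseteq> set xs" using spectrum_subset_roots[OF xs(2)] by auto
  \<comment> \<open>For the empty list the annihilation would read \<open>mat 1 = 0\<close>; any
    diagonal entry refutes this, and \<open>undefined\<close> serves as an index.\<close>
  moreover have "(mat 1 :: complex^'n^'n) $ undefined $ undefined \<noteq> 0" by (simp add: mat_def)
  then have "xs \<noteq> []" using xs(2) by auto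
  ultimately show ?thesis using that by blast
qed

lemma finite_spectrum: "finite (spectrum M)"
  by (metis annihilating_roots List.finite_set)

lemma spectrum_nonempty: "spectrum M \<noteq> {}"
  by (metis annihilating_roots set_empty)

lemma spectral_inclusion:
  assumes "z \<in> spectrum M"
  shows "poly p z \<in> spectrum (poly_mat p M)"
  using assms poly_mat_eigenvector unfolding spectrum_def by blast

text \<open>Newton's form of the resolvent: if \<open>root_poly xs\<close> annihilates \<open>M\<close>, this is
  \<open>(z - M)\<^sup>-\<^sup>1\<close>, written as a combination of the functions \<open>1 / root_poly (take j xs)\<close>.\<close>

fun newton_resolvent :: "'a::field list \<Rightarrow> 'a^'n^'n \<Rightarrow> 'a \<Rightarrow> 'a^'n^'n" where
  "newton_resolvent [] M z = 0"
| "newton_resolvent (x # xs) M z =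
     mat (1 / (z - x)) ** (mat 1 + (M - mat x) ** newton_resolvent xs M z)"

text \<open>The remainder is kept because the induction passes to tails of the list, which need not
  annihilate \<open>M\<close>. The step is the splitting of \<open>z - M\<close> as
  \<open>(z - x) - (M - x)\<close>.\<close>

lemma newton_resolvent_remainder:
  assumes "z \<notin> set xs"
  shows "(mat z - M) ** newton_resolvent xs M z =
           mat 1 - mat (1 / poly (root_poly xs) z) ** poly_mat (root_poly xs) M"
  using assms
proof (induction xs)
  case (Cons x xs)
  define N where "N = mat (1 / poly (root_poly xs) z) ** poly_mat (root_poly xs) M"
  have zx: "z - x \<noteq> 0" using Cons.prems by auto
  have comm: "(mat z - M) ** (M - mat x) = (M - mat x) ** (mat z - M)"
    by (simp add: matrix_diff_ldistrib matrix_diff_rdistrib mat_mul_commute[of M] mat_mul_mat mult.commute)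
  have "(mat z - M) ** newton_resolvent (x # xs) M z =
      mat (1 / (z - x)) ** ((mat z - M) + (M - mat x) ** ((mat z - M) ** newton_resolvent xs M z))"
    by (simp add: mat_mul_left_commute[of "mat z - M"] mat_mul_commute[of "mat z - M"]
        matrix_add_ldistrib matrix_mul_assoc[of "mat z - M" "M - mat x"]
        matrix_mul_assoc[of "M - mat x" "mat z - M"] comm)
  also have "(mat z - M) ** newton_resolvent xs M z = mat 1 - N"
    using Cons by (simp add: N_def)
  also have "(mat z - M) + (M - mat x) ** (mat 1 - N) = mat (z - x) - (M - mat x) ** N"
    by (simp add: matrix_diff_ldistrib mat_diff)
  also have "mat (1 / (z - x)) ** \<dots> = mat 1 - mat (1 / (z - x)) ** ((M - mat x) ** N)"
    using zx by (simp add: matrix_diff_ldistrib mat_mul_mat)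
  also have "mat (1 / (z - x)) ** ((M - mat x) ** N) =
      mat (1 / poly (root_poly (x # xs)) z) ** poly_mat (root_poly (x # xs)) M"
    unfolding N_def root_poly_simps poly_mat_mult poly_mat_linear mat_mul_left_commute[of "M - mat x"]
    by (simp add: matrix_mul_assoc mat_mul_mat algebra_simps)
  finally show ?case .
qed simp

lemma matrix_inv_newton:
  assumes "poly_mat (root_poly xs) M = 0" "z \<notin> set xs"
  shows "matrix_inv (mat z - M) = newton_resolvent xs M z"
  by (rule matrix_inv_unique) (simp add: newton_resolvent_remainder assms)

lemma resolvent_right_inverse:
  "z \<notin> spectrum M \<Longrightarrow> (mat z - M) ** matrix_inv (mat z - M) = mat 1"
proof -
  assume z: "z \<notin> spectrum M"
  obtain xs where "set xs = spectrum M" "poly_mat (root_poly xs) M = 0" by (rule annihilating_roots)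
  then show ?thesis using z by (simp add: matrix_inv_newton newton_resolvent_remainder)
qed

lemma resolvent_left_inverse:
  "z \<notin> spectrum M \<Longrightarrow> matrix_inv (mat z - M) ** (mat z - M) = mat 1"
  using resolvent_right_inverse matrix_left_right_inverse by blast

section \<open>Cauchy integrals of the resolvent\<close>

definition matrix_holomorphic_on :: "(complex \<Rightarrow> complex^'m^'n) \<Rightarrow> complex set \<Rightarrow> bool" where
  "matrix_holomorphic_on F U \<longleftrightarrow> (\<forall>i j. (\<lambda>z. F z $ i $ j) holomorphic_on U)"

lemma matrix_holomorphic_on_const: "matrix_holomorphic_on (\<lambda>z. C) U"
  by (simp add: matrix_holomorphic_on_def)

lemma matrix_holomorphic_on_add:
  "matrix_holomorphic_on F U \<Longrightarrow> matrix_holomorphic_on G U \<Longrightarrow> matrix_holomorphic_on (\<lambda>z. F z + G z) U"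
  by (auto simp: matrix_holomorphic_on_def intro!: holomorphic_intros)

lemma matrix_holomorphic_on_diff:
  "matrix_holomorphic_on F U \<Longrightarrow> matrix_holomorphic_on G U \<Longrightarrow> matrix_holomorphic_on (\<lambda>z. F z - G z) U"
  by (auto simp: matrix_holomorphic_on_def intro!: holomorphic_intros)

lemma matrix_holomorphic_on_mult:
  "matrix_holomorphic_on F U \<Longrightarrow> matrix_holomorphic_on G U \<Longrightarrow> matrix_holomorphic_on (\<lambda>z. F z ** G z) U"
  by (auto simp: matrix_holomorphic_on_def matrix_matrix_mult_def intro!: holomorphic_intros)

lemma matrix_holomorphic_on_mat:
  "h holomorphic_on U \<Longrightarrow> matrix_holomorphic_on (\<lambda>z. mat (h z)) U"
  unfolding matrix_holomorphic_on_def mat_def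
proof (intro allI)
  fix i j assume "h holomorphic_on U"
  then show "(\<lambda>z. (\<chi> i j. if i = j then h z else 0) $ i $ j) holomorphic_on U"
    by (cases "i = j") auto
qed

lemma matrix_holomorphic_on_subset:
  "matrix_holomorphic_on F U \<Longrightarrow> V \<subseteq> U \<Longrightarrow> matrix_holomorphic_on F V"
  unfolding matrix_holomorphic_on_def using holomorphic_on_subset by blast

lemma matrix_holomorphic_on_cong:
  assumes "\<And>z. z \<in> U \<Longrightarrow> F z = G z" "matrix_holomorphic_on F U"
  shows "matrix_holomorphic_on G U"
  unfolding matrix_holomorphic_on_def
proof (intro allI)
  fix i j
  show "(\<lambda>z. G z $ i $ j) holomorphic_on U"
    by (rule holomorphic_transform[of "\<lambda>z. F z $ i $ j"])
      (use assms in \<open>auto simp: matrix_holomorphic_on_def\<close>)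
qed

lemma newton_resolvent_holomorphic: "matrix_holomorphic_on (newton_resolvent xs M) (- set xs)"
proof (induction xs)
  case (Cons x xs)
  have "matrix_holomorphic_on (newton_resolvent xs M) (- set (x # xs))"
    by (rule matrix_holomorphic_on_subset[OF Cons.IH]) auto
  moreover have "(\<lambda>z. 1 / (z - x)) holomorphic_on - set (x # xs)"
    by (intro holomorphic_intros) auto
  ultimately show ?case
    unfolding newton_resolvent.simps
    by (intro matrix_holomorphic_on_mult matrix_holomorphic_on_mat matrix_holomorphic_on_add
        matrix_holomorphic_on_const)
qed (simp add: matrix_holomorphic_on_def)

text \<open>Off the spectrum the resolvent equals Newton's form, a rational function whose poles are
  the listed roots.\<close>

lemma resolvent_holomorphic: "matrix_holomorphic_on (\<lambda>z. matrix_inv (mat z - M)) (- spectrum M)"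
proof -
  obtain xs where xs: "set xs = spectrum M" "poly_mat (root_poly xs) M = 0"
    by (rule annihilating_roots)
  have "newton_resolvent xs M z = matrix_inv (mat z - M)" if "z \<in> - spectrum M" for z
    using matrix_inv_newton[OF xs(2), of z] xs(1) that by simp
  moreover have "matrix_holomorphic_on (newton_resolvent xs M) (- spectrum M)"
    using newton_resolvent_holomorphic[of xs M] unfolding xs(1) .
  ultimately show ?thesis by (rule matrix_holomorphic_on_cong)
qed

section \<open>Contour integrals of matrix functions\<close>

definition matrix_contour_integral ::
  "(real \<Rightarrow> complex) \<Rightarrow> (complex \<Rightarrow> complex^'m^'n) \<Rightarrow> complex^'m^'n" where
  "matrix_contour_integral p F = (\<chi> i j. contour_integral p (\<lambda>z. F z $ i $ j))"

lemma matrix_contour_integral_component [simp]: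
  "matrix_contour_integral p F $ i $ j = contour_integral p (\<lambda>z. F z $ i $ j)"
  by (simp add: matrix_contour_integral_def)

lemma matrix_mult_component: "(A ** B) $ i $ j = (\<Sum>k\<in>UNIV. A $ i $ k * B $ k $ j)"
  by (simp add: matrix_matrix_mult_def)

lemma matrix_eqI: "(\<And>i j. A $ i $ j = B $ i $ j) \<Longrightarrow> A = B"
  by (simp add: vec_eq_iff)

lemma matrix_contour_integral_cong:
  assumes "\<And>z. z \<in> path_image p \<Longrightarrow> F z = G z"
  shows "matrix_contour_integral p F = matrix_contour_integral p G"
proof (rule matrix_eqI)
  fix i j
  show "matrix_contour_integral p F $ i $ j = matrix_contour_integral p G $ i $ j"
    unfolding matrix_contour_integral_component by (rule contour_integral_eq) (simp add: assms)
qed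

text \<open>Just enough for linearity of the integral. It is a locale of its own because the Frechet
  derivative works with a path of which only this is recorded.\<close>

locale contour_in =
  fixes p :: "real \<Rightarrow> complex" and U :: "complex set"
  assumes open_U: "open U" and vp: "valid_path p" and p_in: "path_image p \<subseteq> U"
begin

lemma contour_integrable: "F holomorphic_on U \<Longrightarrow> F contour_integrable_on p"
  using contour_integrable_holomorphic_simple open_U vp p_in by blast

lemma component_integrable:
  "matrix_holomorphic_on F U \<Longrightarrow> (\<lambda>z. F z $ i $ j) contour_integrable_on p"
  unfolding matrix_holomorphic_on_def using contour_integrable by blast

lemma matrix_contour_integral_add:
  assumes "matrix_holomorphic_on F U" "matrix_holomorphic_on G U"
  shows "matrix_contour_integral p (\<lambda>z. F z + G z) = matrix_contour_integral p F + matrix_contour_integral p G"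
proof (rule matrix_eqI)
  fix i j
  show "matrix_contour_integral p (\<lambda>z. F z + G z) $ i $ j =
      (matrix_contour_integral p F + matrix_contour_integral p G) $ i $ j"
    unfolding matrix_contour_integral_component vector_add_component
    by (rule contour_integral_add) (intro component_integrable assms)+
qed

lemma matrix_contour_integral_diff:
  assumes "matrix_holomorphic_on F U" "matrix_holomorphic_on G U"
  shows "matrix_contour_integral p (\<lambda>z. F z - G z) = matrix_contour_integral p F - matrix_contour_integral p G"
proof (rule matrix_eqI)
  fix i j
  show "matrix_contour_integral p (\<lambda>z. F z - G z) $ i $ j =
      (matrix_contour_integral p F - matrix_contour_integral p G) $ i $ j"
    unfolding matrix_contour_integral_component vector_minus_component
    by (rule contour_integral_diff) (intro component_integrable assms)+
qed

lemma matrix_contour_integral_lmul: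
  assumes "matrix_holomorphic_on F U"
  shows "matrix_contour_integral p (\<lambda>z. C ** F z) = C ** matrix_contour_integral p F"
proof (rule matrix_eqI)
  fix i j
  have "matrix_contour_integral p (\<lambda>z. C ** F z) $ i $ j =
      (\<Sum>k\<in>UNIV. contour_integral p (\<lambda>z. C $ i $ k * F z $ k $ j))"
    unfolding matrix_contour_integral_component matrix_mult_component
    by (intro contour_integral_sum contour_integrable_lmul component_integrable assms) auto
  also have "\<dots> = (\<Sum>k\<in>UNIV. C $ i $ k * contour_integral p (\<lambda>z. F z $ k $ j))"
    by (intro sum.cong refl contour_integral_lmul component_integrable assms)
  also have "\<dots> = (C ** matrix_contour_integral p F) $ i $ j"
    by (simp add: matrix_mult_component)
  finally show "matrix_contour_integral p (\<lambda>z. C ** F z) $ i $ j = (C ** matrix_contour_integral p F) $ i $ j" .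
qed

end

text \<open>The approximating path may cross itself; what it inherits from the contour are the
  endpoints and the winding numbers, and these are what the locale asks for.\<close>

locale enclosing_contour = contour_in p "\<Omega> - S" for p \<Omega> and S :: "complex set" +
  assumes fin: "finite S" and open_\<Omega>: "open \<Omega>" and sc: "simply_connected \<Omega>" and S_in: "S \<subseteq> \<Omega>"
    and closed_p: "pathfinish p = pathstart p" and wn: "\<And>s. s \<in> S \<Longrightarrow> winding_number p s = 1"
begin

section \<open>Rational functions with poles in the enclosed set\<close>

lemma Cauchy: "F holomorphic_on \<Omega> \<Longrightarrow> contour_integral p F = 0"
  using Cauchy_theorem_simply_connected[OF open_\<Omega> sc _ vp _ closed_p] p_in
  by (blast intro: contour_integral_unique)

lemma contour_integral_inverse:
  assumes "a \<in> S" shows "contour_integral p (\<lambda>z. 1 / (z - a)) = 2 * of_real pi * \<i>"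
proof -
  have "a \<notin> path_image p" using assms p_in by auto
  then have "1 = 1 / (2 * of_real pi * \<i>) * contour_integral p (\<lambda>z. 1 / (z - a))"
    using winding_number_valid_path[OF vp, of a] wn[OF assms] by simp
  then show ?thesis by (metis divide_eq_1_iff times_divide_eq_left mult_1)
qed

text \<open>For such \<open>n\<close> the integrand has a single-valued primitive, a multiple of
  \<open>1 / (z - a) ^ (n - 1)\<close>.\<close>

lemma contour_integral_inverse_power:
  assumes "a \<in> S" "n \<ge> 2"
  shows "contour_integral p (\<lambda>z. 1 / (z - a) ^ n) = 0"
proof -
  obtain k where n: "n = Suc (Suc k)" using assms(2) by (metis Suc_le_D numeral_2_eq_2 Suc_le_mono)
  have "((\<lambda>z. - 1 / of_nat (Suc k) * inverse ((z - a) ^ Suc k)) has_field_derivative 1 / (z - a) ^ n) (at z within \<Omega> - S)"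
    if "z \<in> \<Omega> - S" for z
  proof -
    have nz: "z - a \<noteq> 0" "of_nat (Suc k) \<noteq> (0 :: complex)"
      using assms(1) that of_nat_neq_0[of k, where 'a = complex] by auto
    have d: "((\<lambda>z. (z - a) ^ Suc k) has_field_derivative of_nat (Suc k) * (z - a) ^ k) (at z within \<Omega> - S)"
      by (rule derivative_eq_intros refl | simp)+
    have "(z - a) ^ Suc k \<noteq> 0" using nz by simp
    from DERIV_cmult[OF DERIV_inverse_fun[OF d this], of "- 1 / of_nat (Suc k)"] show ?thesis
      using nz
      unfolding n by (elim DERIV_cong) (auto simp: divide_simps simp del: of_nat_Suc)
  qed
  from Cauchy_theorem_primitive[OF this vp p_in closed_p] show ?thesis
    by (rule contour_integral_unique)
qed

text \<open>The function decays like \<open>1 / z^2\<close>, so its residues sum to zero. This is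
  proved by partial fractions: two distinct roots \<open>a\<close> and \<open>b\<close> are
  separated, which leaves two products with one factor less; if all roots coincide, the integrand is
  a pure power.\<close>

lemma contour_integral_inverse_root_poly:
  assumes "set ys \<subseteq> S" "length ys \<ge> 2"
  shows "contour_integral p (\<lambda>z. 1 / poly (root_poly ys) z) = 0"
  using assms
proof (induction "length ys" arbitrary: ys rule: less_induct)
  case less
  obtain a ys' where ys: "ys = a # ys'" using less.prems(2) by (cases ys) auto
  then have "ys' \<noteq> []" using less.prems(2) by auto
  have a: "a \<in> S" using less.prems ys by auto
  show ?case
  proof (cases "set ys' \<subseteq> {a}")
    case True
    have "poly (root_poly zs) z = (z - a) ^ length zs" if "set zs \<subseteq> {a}" for zs z
      using that by (induction zs) (auto simp: algebra_simps)
    from this[of ys] show ?thesis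
      using True ys less.prems contour_integral_inverse_power[OF a, of "length ys"] by simp
  next
    case False
    then obtain b u v where uv: "ys' = u @ b # v" "b \<noteq> a" by (metis split_list subsetI singletonI)
    have b: "b \<in> S" using less.prems ys uv by auto
    define R where "R z = poly (root_poly (u @ v)) z" for z
    have N: "poly (root_poly ys) z = (z - a) * ((z - b) * R z)" for z
      by (simp add: ys uv R_def root_poly_def algebra_simps)
    have Ra: "poly (root_poly (a # u @ v)) z = (z - a) * R z" for a z
      by (simp add: R_def algebra_simps)
    have hol: "(\<lambda>z. 1 / poly (root_poly zs) z) holomorphic_on \<Omega> - S" if "set zs \<subseteq> S" for zs
      using that by (intro holomorphic_intros) auto
    have sub: "set (a # u @ v) \<subseteq> S" "set (b # u @ v) \<subseteq> S"
      using less.prems ys uv by auto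
    have "contour_integral p (\<lambda>z. 1 / poly (root_poly ys) z) =
      contour_integral p (\<lambda>z. (1 / (a - b)) * (1 / poly (root_poly (a # u @ v)) z - 1 / poly (root_poly (b # u @ v)) z))"
    proof (rule contour_integral_eq)
      fix z assume "z \<in> path_image p"
      then have "z \<notin> S" using p_in by auto
      then have "z - a \<noteq> 0" "z - b \<noteq> 0" "R z \<noteq> 0" "a - b \<noteq> 0"
        using a b uv less.prems ys by (auto simp: R_def)
      then show "1 / poly (root_poly ys) z =
          (1 / (a - b)) * (1 / poly (root_poly (a # u @ v)) z - 1 / poly (root_poly (b # u @ v)) z)"
        unfolding N Ra by (simp add: divide_simps)
    qed
    also have "\<dots> = (1 / (a - b)) * (contour_integral p (\<lambda>z. 1 / poly (root_poly (a # u @ v)) z)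
        - contour_integral p (\<lambda>z. 1 / poly (root_poly (b # u @ v)) z))"
      using hol[OF sub(1)] hol[OF sub(2)]
      by (subst contour_integral_lmul) (auto intro!: contour_integrable holomorphic_intros
          simp: contour_integral_diff contour_integrable simp del: root_poly_simps)
    \<comment> \<open>With only two roots the remaining integrals are those of simple poles, both
      equal to 2 \<pi> i, and they cancel; otherwise each of them vanishes by induction.\<close>
    also have "\<dots> = 0"
    proof (cases "u @ v = []")
      case True
      then show ?thesis by (simp add: contour_integral_inverse[OF a] contour_integral_inverse[OF b])
    next
      case False
      have "contour_integral p (\<lambda>z. 1 / poly (root_poly (a # u @ v)) z) = 0"
        "contour_integral p (\<lambda>z. 1 / poly (root_poly (b # u @ v)) z) = 0"
        using less.hyps[of "a # u @ v"] less.hyps[of "b # u @ v"] sub False ys uv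
        by (auto simp: Suc_le_eq simp del: root_poly_simps)
      then show ?thesis by simp
    qed
    finally show ?thesis .
  qed
qed

lemma matrix_contour_integral_mat:
  "matrix_contour_integral p (\<lambda>z. mat (h z)) = mat (contour_integral p h)"
  by (simp add: matrix_contour_integral_def mat_def vec_eq_iff)

text \<open>Every term of Newton's form has a pole factor of its own, so together with those of
  \<open>ys\<close> there are at least two and the integral vanishes. The induction moves the head
  of \<open>xs\<close> to \<open>ys\<close>.\<close>

lemma matrix_contour_integral_newton_decay:
  assumes "set xs \<subseteq> S" "set ys \<subseteq> S" "ys \<noteq> []"
  shows "matrix_contour_integral p (\<lambda>z. mat (1 / poly (root_poly ys) z) ** newton_resolvent xs M z) = 0"
  using assms
proof (induction xs arbitrary: ys)
  case Nil
  then show ?case by (simp add: matrix_contour_integral_def vec_eq_iff)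
next
  case (Cons x xs)
  have hol: "matrix_holomorphic_on (newton_resolvent xs M) (\<Omega> - S)"
    by (rule matrix_holomorphic_on_subset[OF newton_resolvent_holomorphic]) (use Cons.prems in auto)
  have hol': "(\<lambda>z. 1 / poly (root_poly (x # ys)) z) holomorphic_on \<Omega> - S"
    using Cons.prems by (intro holomorphic_intros) (auto simp del: root_poly_simps)
  have "mat (1 / poly (root_poly ys) z) ** newton_resolvent (x # xs) M z =
      mat (1 / poly (root_poly (x # ys)) z) +
      (M - mat x) ** (mat (1 / poly (root_poly (x # ys)) z) ** newton_resolvent xs M z)" for z
    by (simp add: matrix_mul_assoc mat_mul_mat matrix_add_ldistrib mat_mul_commute[of "M - mat x"] algebra_simps)
  then show ?case
    using Cons.IH[of "x # ys"] contour_integral_inverse_root_poly[of "x # ys"] Cons.prems hol hol'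
    by (simp add: matrix_contour_integral_add matrix_contour_integral_lmul matrix_contour_integral_mat
        matrix_holomorphic_on_add matrix_holomorphic_on_mult matrix_holomorphic_on_mat
        matrix_holomorphic_on_const Suc_le_eq del: root_poly_simps newton_resolvent.simps)
qed

text \<open>Only the leading term \<open>1 / (z - x)\<close> contributes; the later ones decay too
  fast.\<close>

lemma matrix_contour_integral_newton_resolvent:
  assumes "set xs \<subseteq> S" "xs \<noteq> []"
  shows "matrix_contour_integral p (newton_resolvent xs M) = mat (2 * of_real pi * \<i>)"
proof -
  obtain x xs' where xs: "xs = x # xs'" using assms(2) by (cases xs) auto
  have x: "x \<in> S" "set xs' \<subseteq> S" using assms xs by auto
  have hol: "matrix_holomorphic_on (newton_resolvent xs' M) (\<Omega> - S)"
    by (rule matrix_holomorphic_on_subset[OF newton_resolvent_holomorphic]) (use x in auto)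
  have hol': "(\<lambda>z. 1 / (z - x)) holomorphic_on \<Omega> - S"
    using x by (intro holomorphic_intros) auto
  have "newton_resolvent xs M z = mat (1 / (z - x)) +
      (M - mat x) ** (mat (1 / poly (root_poly [x]) z) ** newton_resolvent xs' M z)" for z
    by (simp add: xs matrix_mul_assoc matrix_add_ldistrib mat_mul_commute[of "M - mat x"])
  then have "newton_resolvent xs M = (\<lambda>z. mat (1 / (z - x)) +
      (M - mat x) ** (mat (1 / poly (root_poly [x]) z) ** newton_resolvent xs' M z))" by blast
  then show ?thesis
    using matrix_contour_integral_newton_decay[of xs' "[x]" M] x hol hol'
    by (simp add: matrix_contour_integral_add matrix_contour_integral_lmul matrix_contour_integral_mat
        matrix_holomorphic_on_add matrix_holomorphic_on_mult matrix_holomorphic_on_mat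
        matrix_holomorphic_on_const contour_integral_inverse)
qed

end

section \<open>Difference quotients and Hermite interpolation\<close>

lemma difference_quotient:
  assumes "h holomorphic_on \<Omega>" "open \<Omega>" "x \<in> \<Omega>"
  obtains k where "k holomorphic_on \<Omega>" "\<And>z. h z = h x + (z - x) * k z"
proof -
  define k where "k z = (if z = x then deriv h x else (h z - h x) / (z - x))" for z
  have "(\<lambda>z. if z = x then deriv h x else h z / (z - x) - h x / (z - x)) holomorphic_on \<Omega>"
    using pole_theorem_open[OF assms(1,2), where a = x and f = "\<lambda>z. h z / (z - x)"] by simp
  then have "k holomorphic_on \<Omega>"
    by (rule holomorphic_transform) (simp add: k_def diff_divide_distrib)
  then show ?thesis by (rule that) (simp add: k_def)
qed

text \<open>Iterating the difference quotient along the list yields the divided differences of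
  \<open>h\<close>; \<open>q\<close> is assembled from them in Newton's form, and a repeated root
  produces derivatives.\<close>

lemma hermite_interpolation:
  assumes "h holomorphic_on \<Omega>" "open \<Omega>" "set xs \<subseteq> \<Omega>"
  obtains q r where "r holomorphic_on \<Omega>" "\<And>z. h z = poly q z + poly (root_poly xs) z * r z"
proof -
  have "\<exists>q r. r holomorphic_on \<Omega> \<and> (\<forall>z. h z = poly q z + poly (root_poly xs) z * r z)"
    using assms
  proof (induction xs arbitrary: h)
    case Nil
    then show ?case by (intro exI[of _ 0] exI[of _ h]) simp
  next
    case (Cons x xs)
    then obtain k where k: "k holomorphic_on \<Omega>" "\<And>z. h z = h x + (z - x) * k z"
      using difference_quotient[of h \<Omega> x] by auto
    obtain q r where qr: "r holomorphic_on \<Omega>" "\<And>z. k z = poly q z + poly (root_poly xs) z * r z"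
      using Cons.IH[OF k(1)] Cons.prems by auto
    have "h z = poly ([:h x:] + [:- x, 1:] * q) z + poly (root_poly (x # xs)) z * r z" for z
      by (subst k(2)) (simp add: qr(2) algebra_simps)
    then show ?case using qr(1) by blast
  qed
  then show ?thesis using that by blast
qed

text \<open>The interpolant and the value of the integral are produced by the same recursion. The
  list is arbitrary within \<open>S\<close>, since the tails met in the induction need not
  annihilate \<open>M\<close>.\<close>

lemma (in enclosing_contour) newton_calculus:
  fixes M :: "complex^'n^'n"
  assumes "h holomorphic_on \<Omega>" "set xs \<subseteq> S"
  shows "\<exists>q r. r holomorphic_on \<Omega> \<and> (\<forall>z. h z = poly q z + poly (root_poly xs) z * r z) \<and>
    matrix_contour_integral p (\<lambda>z. mat (h z) ** newton_resolvent xs M z) =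
      mat (2 * of_real pi * \<i>) ** poly_mat q M"
  using assms
proof (induction xs arbitrary: h)
  case Nil
  then show ?case
    by (intro exI[of _ 0] exI[of _ h]) (simp add: matrix_contour_integral_def vec_eq_iff)
next
  case (Cons x xs)
  have x: "x \<in> S" "x \<in> \<Omega>" using Cons.prems S_in by auto
  obtain k where k: "k holomorphic_on \<Omega>" "\<And>z. h z = h x + (z - x) * k z"
    using difference_quotient[OF Cons.prems(1) open_\<Omega> x(2)] by auto
  have "set xs \<subseteq> S" using Cons.prems by auto
  from Cons.IH[OF k(1) this] obtain q r where qr: "r holomorphic_on \<Omega>"
    "\<And>z. k z = poly q z + poly (root_poly xs) z * r z"
    "matrix_contour_integral p (\<lambda>z. mat (k z) ** newton_resolvent xs M z) =
      mat (2 * of_real pi * \<i>) ** poly_mat q M" by blast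
  have hol: "matrix_holomorphic_on (newton_resolvent zs M) (\<Omega> - S)" if "set zs \<subseteq> S" for zs
    by (rule matrix_holomorphic_on_subset[OF newton_resolvent_holomorphic]) (use that in auto)
  have k': "k holomorphic_on \<Omega> - S" using k(1) by (rule holomorphic_on_subset) auto
  have "mat (h z) ** newton_resolvent (x # xs) M z = mat (h x) ** newton_resolvent (x # xs) M z +
      (mat (k z) + (M - mat x) ** (mat (k z) ** newton_resolvent xs M z))"
    if "z \<in> path_image p" for z
  proof -
    have "z - x \<noteq> 0" using that p_in x by auto
    then have "mat (z - x) ** newton_resolvent (x # xs) M z = mat 1 + (M - mat x) ** newton_resolvent xs M z"
      by (simp add: matrix_mul_assoc mat_mul_mat)
    then have "mat (k z) ** (mat (z - x) ** newton_resolvent (x # xs) M z) =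
        mat (k z) + (M - mat x) ** (mat (k z) ** newton_resolvent xs M z)"
      by (simp add: matrix_add_ldistrib mat_mul_left_commute[of "M - mat x"])
    moreover have "(mat (h z) :: complex^'n^'n) = mat (h x) + mat (k z) ** mat (z - x)"
      by (subst k(2)) (simp add: mat_add mat_mul_mat mult.commute)
    ultimately show ?thesis
      by (simp only: matrix_add_rdistrib flip: matrix_mul_assoc)
  qed
  then have "matrix_contour_integral p (\<lambda>z. mat (h z) ** newton_resolvent (x # xs) M z) =
    matrix_contour_integral p (\<lambda>z. mat (h x) ** newton_resolvent (x # xs) M z +
      (mat (k z) + (M - mat x) ** (mat (k z) ** newton_resolvent xs M z)))"
    by (rule matrix_contour_integral_cong)
  \<comment> \<open>The constant \<open>h x\<close> meets the integral of Newton's form,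
    \<open>k\<close> integrates to 0 by Cauchy's theorem, and the last term is the induction
    hypothesis.\<close>
  also have "\<dots> = mat (h x) ** mat (2 * of_real pi * \<i>) +
      (0 + (M - mat x) ** (mat (2 * of_real pi * \<i>) ** poly_mat q M))"
    using hol[OF Cons.prems(2)] hol[OF \<open>set xs \<subseteq> S\<close>] k' k(1) Cons.prems
    by (simp add: matrix_contour_integral_add matrix_contour_integral_lmul matrix_contour_integral_mat
        matrix_holomorphic_on_add matrix_holomorphic_on_mult matrix_holomorphic_on_mat Cauchy
        matrix_holomorphic_on_const matrix_contour_integral_newton_resolvent qr(3)
        del: newton_resolvent.simps)
  also have "\<dots> = mat (2 * of_real pi * \<i>) ** poly_mat ([:h x:] + [:- x, 1:] * q) M"
    unfolding poly_mat_add poly_mat_mult poly_mat_linear mat_mul_left_commute[of "M - mat x"]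
    by (simp add: matrix_add_ldistrib mat_mul_mat mult.commute)
  finally have "matrix_contour_integral p (\<lambda>z. mat (h z) ** newton_resolvent (x # xs) M z) =
    mat (2 * of_real pi * \<i>) ** poly_mat ([:h x:] + [:- x, 1:] * q) M" .
  moreover have "h z = poly ([:h x:] + [:- x, 1:] * q) z + poly (root_poly (x # xs)) z * r z" for z
    by (subst k(2)) (simp add: qr(2) algebra_simps)
  ultimately show ?case using qr(1) by blast
qed

text \<open>Used to compare two interpolants of one function. The roots are divided out one by one;
  after each division the identity holds away from the root, and continuity of \<open>r\<close>
  restores it there, which also handles repeated roots.\<close>

lemma root_poly_dvd:
  fixes q :: "complex poly"
  assumes "open V" "set xs \<subseteq> V" "continuous_on V r"
    and "\<And>z. z \<in> V \<Longrightarrow> poly q z = poly (root_poly xs) z * r z"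
  shows "root_poly xs dvd q"
  using assms
proof (induction xs arbitrary: q)
  case (Cons x xs)
  have x: "x \<in> V" using Cons.prems by auto
  then have "poly q x = 0" using Cons.prems(4) by simp
  then obtain q' where q: "q = [:- x, 1:] * q'" by (auto simp: poly_eq_0_iff_dvd)
  have off: "poly q' z = poly (root_poly xs) z * r z" if "z \<in> V" "z \<noteq> x" for z
  proof -
    have "(z - x) * poly q' z = (z - x) * (poly (root_poly xs) z * r z)"
      using Cons.prems(4)[OF that(1)] by (simp add: q algebra_simps)
    then show ?thesis using that(2) by simp
  qed
  have "isCont (\<lambda>z. poly (root_poly xs) z * r z) x"
    using Cons.prems(1,3) x by (auto simp: continuous_on_eq_continuous_at intro!: continuous_intros)
  then have "((\<lambda>z. poly (root_poly xs) z * r z) \<longlongrightarrow> poly (root_poly xs) x * r x) (at x)"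
    by (simp add: isCont_def)
  moreover have "eventually (\<lambda>z. poly (root_poly xs) z * r z = poly q' z) (at x)"
    using eventually_at_in_open'[OF Cons.prems(1) x] off
    by (auto simp: eventually_at_filter elim!: eventually_mono)
  ultimately have "(poly q' \<longlongrightarrow> poly (root_poly xs) x * r x) (at x)"
    by (rule Lim_transform_eventually)
  moreover have "(poly q' \<longlongrightarrow> poly q' x) (at x)" using poly_isCont isCont_def by blast
  ultimately have "poly q' x = poly (root_poly xs) x * r x" using LIM_unique by blast
  with off have "root_poly xs dvd q'" using Cons.prems by (intro Cons.IH) auto
  then show ?case unfolding q root_poly_simps by (rule mult_dvd_mono[OF dvd_refl])
qed simp

section \<open>Matrix functions as polynomials of the matrix\<close>

lemma encloses_spectrum_subset:
  assumes "open \<Omega>" "simply_connected \<Omega>" "encloses_spectrum \<Gamma> \<Omega> S"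
  shows "S \<subseteq> \<Omega>"
proof
  fix z assume "z \<in> S"
  then have "winding_number \<Gamma> z = 1" using assms unfolding encloses_spectrum_def by blast
  \<comment> \<open>Around a point outside the simply connected \<Omega> the winding number would be
    0.\<close>
  then show "z \<in> \<Omega>"
    using simply_connected_imp_winding_number_zero[OF assms(2), of \<Gamma> z] assms(3)
    unfolding encloses_spectrum_def rectifiable_path_def by fastforce
qed

lemma encloses_spectrum_mono: "encloses_spectrum \<Gamma> \<Omega> S \<Longrightarrow> T \<subseteq> S \<Longrightarrow> encloses_spectrum \<Gamma> \<Omega> T"
  unfolding encloses_spectrum_def by blast

lemma encloses_spectrum_disjoint: "encloses_spectrum \<Gamma> \<Omega> S \<Longrightarrow> path_image \<Gamma> \<inter> S = {}"
  unfolding encloses_spectrum_def using inside_no_overlap by blast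

text \<open>The bridge on which all algebraic rules rest. The cofactor \<open>r\<close> lives on any
  neighbourhood \<open>V\<close> of the spectrum, which may miss the contour; the composition rule
  depends on this freedom.\<close>

lemma matrix_fun_eq_poly_mat:
  fixes M :: "complex^'n^'n"
  assumes \<Omega>: "open \<Omega>" "simply_connected \<Omega>" and h: "h holomorphic_on \<Omega>"
    and enc: "encloses_spectrum \<Gamma> \<Omega> (spectrum M)"
    and xs: "set xs = spectrum M" "poly_mat (root_poly xs) M = 0"
    and V: "open V" "spectrum M \<subseteq> V" "continuous_on V r"
    and eq: "\<And>z. z \<in> V \<Longrightarrow> h z = poly q z + poly (root_poly xs) z * r z"
  shows "matrix_fun \<Gamma> h M = poly_mat q M"
proof -
  have S_in: "spectrum M \<subseteq> \<Omega>" by (rule encloses_spectrum_subset[OF \<Omega> enc])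
  \<comment> \<open>Off the spectrum the resolvent is holomorphic, and a path approximation inside
    this set preserves the winding numbers about the removed points.\<close>
  have "open (\<Omega> - spectrum M)" using \<Omega> finite_spectrum by (intro open_Diff finite_imp_closed)
  moreover have "path_image \<Gamma> \<subseteq> \<Omega> - spectrum M"
    using enc encloses_spectrum_disjoint[OF enc] unfolding encloses_spectrum_def by blast
  ultimately obtain p where p: "valid_path p" "path_image p \<subseteq> \<Omega> - spectrum M"
    "pathstart p = pathstart \<Gamma>" "pathfinish p = pathfinish \<Gamma>"
    "\<And>w. w \<notin> \<Omega> - spectrum M \<Longrightarrow> winding_number p w = winding_number \<Gamma> w"
    "\<And>F. F holomorphic_on (\<Omega> - spectrum M) \<Longrightarrow> has_line_integral F (contour_integral p F) \<Gamma>"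
    using valid_path_approximation[of \<Gamma> "\<Omega> - spectrum M"] enc unfolding encloses_spectrum_def by metis
  interpret enclosing_contour p \<Omega> "spectrum M"
    using p \<open>open (\<Omega> - spectrum M)\<close> \<Omega> finite_spectrum S_in enc
    by unfold_locales (auto simp: encloses_spectrum_def)
  obtain q' r' where q': "r' holomorphic_on \<Omega>" "\<And>z. h z = poly q' z + poly (root_poly xs) z * r' z"
    "matrix_contour_integral p (\<lambda>z. mat (h z) ** newton_resolvent xs M z) =
      mat (2 * of_real pi * \<i>) ** poly_mat q' M"
    using newton_calculus[OF h, of xs M] xs(1) by auto
  have hol: "matrix_holomorphic_on (\<lambda>z. mat (h z) ** matrix_inv (mat z - M)) (\<Omega> - spectrum M)"
    using h by (intro matrix_holomorphic_on_mult matrix_holomorphic_on_mat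
        matrix_holomorphic_on_subset[OF resolvent_holomorphic]) (auto intro: holomorphic_on_subset)
  then have "matrix_line_integral \<Gamma> (\<lambda>z. mat (h z) ** matrix_inv (mat z - M)) =
      matrix_contour_integral p (\<lambda>z. mat (h z) ** matrix_inv (mat z - M))"
    unfolding matrix_line_integral_def matrix_contour_integral_def matrix_holomorphic_on_def
    by (simp add: line_integral_eqI[OF p(6)])
  also have "\<dots> = matrix_contour_integral p (\<lambda>z. mat (h z) ** newton_resolvent xs M z)"
    using p(2) xs by (intro matrix_contour_integral_cong) (auto simp: matrix_inv_newton)
  finally have "matrix_fun \<Gamma> h M = poly_mat q' M"
    unfolding matrix_fun_def q'(3) by (simp add: matrix_mul_assoc mat_mul_mat)
  \<comment> \<open>\<open>q'\<close> comes from the contour integral and \<open>q\<close> is the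
    given interpolant; both match \<open>h\<close> modulo the annihilating polynomial near the
    spectrum.\<close>
  moreover have "root_poly xs dvd q' - q"
  proof (rule root_poly_dvd[of "V \<inter> \<Omega>" xs "\<lambda>z. r z - r' z"])
    show "poly (q' - q) z = poly (root_poly xs) z * (r z - r' z)" if "z \<in> V \<inter> \<Omega>" for z
      using eq[of z] q'(2)[of z] that by (simp add: algebra_simps)
  qed (use V \<Omega> S_in xs q'(1) in \<open>auto intro!: continuous_intros
      intro: continuous_on_subset holomorphic_on_imp_continuous_on\<close>)
  then have "poly_mat (q' - q) M = 0" using xs(2) by (auto simp: poly_mat_mult elim: dvdE)
  ultimately show ?thesis by (simp add: poly_mat_diff)
qed

section \<open>Block triangular matrices and the functional calculus\<close>

definition block_upper ::
  "'a::zero^'n^'n \<Rightarrow> 'a^'d^'n \<Rightarrow> 'a^'d^'d \<Rightarrow> 'a^('n + 'd)^('n + 'd)" where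
  "block_upper A E B = (\<chi> i j. case i of
      Inl i' \<Rightarrow> (case j of Inl j' \<Rightarrow> A $ i' $ j' | Inr j' \<Rightarrow> E $ i' $ j')
    | Inr i' \<Rightarrow> (case j of Inl j' \<Rightarrow> 0 | Inr j' \<Rightarrow> B $ i' $ j'))"

lemma block_upper_component [simp]:
  "block_upper A E B $ Inl i $ Inl j = A $ i $ j"
  "block_upper A E B $ Inl i $ Inr k = E $ i $ k"
  "block_upper A E B $ Inr l $ Inl j = 0"
  "block_upper A E B $ Inr l $ Inr k = B $ l $ k"
  by (simp_all add: block_upper_def)

lemma block_matrix_eqI:
  fixes X Y :: "'a^('n::finite + 'd::finite)^('n + 'd)"
  assumes "\<And>i j. X $ Inl i $ Inl j = Y $ Inl i $ Inl j" "\<And>i k. X $ Inl i $ Inr k = Y $ Inl i $ Inr k"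
    "\<And>l j. X $ Inr l $ Inl j = Y $ Inr l $ Inl j" "\<And>l k. X $ Inr l $ Inr k = Y $ Inr l $ Inr k"
  shows "X = Y"
proof (rule matrix_eqI)
  fix i j show "X $ i $ j = Y $ i $ j" using assms by (cases i; cases j) auto
qed

lemma block_upper_eq_iff:
  "block_upper A E B = block_upper A' E' B' \<longleftrightarrow> A = A' \<and> E = E' \<and> B = B'"
proof
  assume eq: "block_upper A E B = block_upper A' E' B'"
  then have "block_upper A E B $ i $ j = block_upper A' E' B' $ i $ j" for i j by simp
  from this[of "Inl _" "Inl _"] this[of "Inl _" "Inr _"] this[of "Inr _" "Inr _"]
  show "A = A' \<and> E = E' \<and> B = B'" by (simp add: vec_eq_iff)
qed simp

lemma sum_UNIV_sum_type:
  "(\<Sum>k\<in>(UNIV :: ('n::finite + 'd::finite) set). f k) = (\<Sum>k\<in>UNIV. f (Inl k)) + (\<Sum>k\<in>UNIV. f (Inr k))"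
  using sum.Plus[of "UNIV :: 'n set" "UNIV :: 'd set" f] by (simp add: o_def)

lemma block_upper_mult:
  "block_upper A E B ** block_upper A' E' B' = block_upper (A ** A') (A ** E' + E ** B') (B ** B')"
  for A A' :: "'a::semiring_1^'n^'n" and B B' :: "'a^'d^'d"
  by (rule block_matrix_eqI) (simp_all add: matrix_mult_component sum_UNIV_sum_type)

lemma block_upper_add:
  "block_upper A E B + block_upper A' E' B' = block_upper (A + A') (E + E') (B + (B' :: 'a::monoid_add^'d^'d))"
  by (rule block_matrix_eqI) simp_all

lemma block_upper_mat: "mat c = block_upper (mat c) 0 (mat c)"
  by (rule block_matrix_eqI) (simp_all add: mat_def)

text \<open>The lower part of an eigenvector is an eigenvector of \<open>B\<close> if it is nonzero;
  if it is zero, the upper part is an eigenvector of \<open>A\<close>.\<close>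

lemma spectrum_block_upper: "spectrum (block_upper A E B) \<subseteq> spectrum A \<union> spectrum B"
proof
  fix z assume "z \<in> spectrum (block_upper A E B)"
  then obtain w where w: "w \<noteq> 0" "block_upper A E B *v w = z *s w" unfolding spectrum_def by blast
  define u v where "u = (\<chi> i. w $ Inl i)" and "v = (\<chi> i. w $ Inr i)"
  have comp: "(block_upper A E B *v w) $ i = z * w $ i" for i using w(2) by simp
  have "(B *v v) $ i = (z *s v) $ i" for i
    using comp[of "Inr i"] by (simp add: matrix_vector_mult_def sum_UNIV_sum_type v_def)
  then have v: "B *v v = z *s v" by (simp add: vec_eq_iff)
  show "z \<in> spectrum A \<union> spectrum B"
  proof (cases "v = 0")
    case True
    then have v0: "w $ Inr i = 0" for i by (simp add: v_def vec_eq_iff)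
    have "(A *v u) $ i = (z *s u) $ i" for i
      using comp[of "Inl i"] by (simp add: matrix_vector_mult_def sum_UNIV_sum_type u_def v0)
    then have "A *v u = z *s u" by (simp add: vec_eq_iff)
    moreover have "u \<noteq> 0"
    proof
      assume "u = 0"
      then have "w $ i = 0" for i using v0 by (cases i) (simp_all add: u_def vec_eq_iff)
      with w(1) show False by (simp add: vec_eq_iff)
    qed
    ultimately show ?thesis unfolding spectrum_def by blast
  next
    case False
    then show ?thesis using v unfolding spectrum_def by blast
  qed
qed

text \<open>The corner of the block resolvent is the kernel in the definition of
  \<open>D_op\<close>; the off-diagonal block of the product with \<open>z - M\<close>
  cancels.\<close>

lemma matrix_inv_block_upper:
  fixes A :: "complex^'n^'n" and B :: "complex^'d^'d"
  assumes "z \<notin> spectrum A" "z \<notin> spectrum B"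
  shows "matrix_inv (mat z - block_upper A E B) =
    block_upper (matrix_inv (mat z - A))
      (matrix_inv (mat z - A) ** E ** matrix_inv (mat z - B)) (matrix_inv (mat z - B))"
    (is "_ = block_upper ?R ?X ?S")
proof (rule matrix_inv_unique)
  have RS: "(mat z - A) ** ?R = mat 1" "(mat z - B) ** ?S = mat 1"
    using assms resolvent_right_inverse by blast+
  have "mat z - block_upper A E B = block_upper (mat z - A) (- E) (mat z - B)"
    by (rule block_matrix_eqI) (simp_all add: mat_def)
  then have "(mat z - block_upper A E B) ** block_upper ?R ?X ?S =
      block_upper (mat 1) ((mat z - A) ** ?X + (- E) ** ?S) (mat 1)"
    by (simp add: block_upper_mult RS)
  also have "(mat z - A) ** ?X + (- E) ** ?S = (mat 1 - mat 1) ** E ** ?S"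
    by (simp add: matrix_mul_assoc RS) (simp add: matrix_mult_component sum_negf vec_eq_iff)
  also have "\<dots> = 0" by simp
  also have "block_upper (mat 1) 0 (mat 1) = (mat 1 :: complex^('n + 'd)^('n + 'd))"
    by (rule block_upper_mat[symmetric])
  finally show "(mat z - block_upper A E B) ** block_upper ?R ?X ?S = mat 1" .
qed

lemma matrix_line_integral_cong:
  assumes "\<And>z. z \<in> path_image \<gamma> \<Longrightarrow> F z = G z"
  shows "matrix_line_integral \<gamma> F = matrix_line_integral \<gamma> G"
proof (rule matrix_eqI)
  fix i j
  have "line_integral \<gamma> (\<lambda>z. F z $ i $ j) = line_integral \<gamma> (\<lambda>z. G z $ i $ j)"
    by (rule line_integral_cong) (simp add: assms)
  then show "matrix_line_integral \<gamma> F $ i $ j = matrix_line_integral \<gamma> G $ i $ j"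
    by (simp add: matrix_line_integral_def)
qed

text \<open>The two sides agree entry by entry, whatever values the line integrals of the three
  nontrivial blocks have; the lower left block is the integral of 0.\<close>

lemma matrix_fun_block_upper:
  assumes "path_image \<Gamma> \<inter> (spectrum A \<union> spectrum B) = {}"
  shows "matrix_fun \<Gamma> h (block_upper A E B) =
    block_upper (matrix_fun \<Gamma> h A) (D_op \<Gamma> h A B E) (matrix_fun \<Gamma> h B)"
proof -
  let ?R = "\<lambda>z. matrix_inv (mat z - A)" and ?S = "\<lambda>z. matrix_inv (mat z - B)"
  have "mat (h z) ** matrix_inv (mat z - block_upper A E B) =
      block_upper (mat (h z) ** ?R z) (mat (h z) ** ?R z ** E ** ?S z) (mat (h z) ** ?S z)"
    if "z \<in> path_image \<Gamma>" for z
  proof -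
    have "z \<notin> spectrum A" "z \<notin> spectrum B" using assms that by auto
    then show ?thesis
      by (simp add: matrix_inv_block_upper block_upper_mat[of "h z"] block_upper_mult matrix_mul_assoc)
  qed
  then have "matrix_line_integral \<Gamma> (\<lambda>z. mat (h z) ** matrix_inv (mat z - block_upper A E B)) =
    matrix_line_integral \<Gamma> (\<lambda>z. block_upper (mat (h z) ** ?R z) (mat (h z) ** ?R z ** E ** ?S z) (mat (h z) ** ?S z))"
    by (rule matrix_line_integral_cong)
  also have "\<dots> = block_upper (matrix_line_integral \<Gamma> (\<lambda>z. mat (h z) ** ?R z))
      (matrix_line_integral \<Gamma> (\<lambda>z. mat (h z) ** ?R z ** E ** ?S z))
      (matrix_line_integral \<Gamma> (\<lambda>z. mat (h z) ** ?S z))"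
    by (rule block_matrix_eqI)
      (simp_all only: matrix_line_integral_def vec_lambda_beta block_upper_component line_integral_zero)
  finally show ?thesis
    unfolding matrix_fun_def D_op_def
    by (simp add: block_upper_mat[of "1 / _"] block_upper_mult)
qed

lemma matrix_fun_hermite:
  fixes M :: "complex^'n^'n"
  assumes "open \<Omega>" "simply_connected \<Omega>" "h holomorphic_on \<Omega>" "encloses_spectrum \<Gamma> \<Omega> (spectrum M)"
    and "set xs = spectrum M" "poly_mat (root_poly xs) M = 0"
  shows "\<exists>q r. r holomorphic_on \<Omega> \<and> (\<forall>z. h z = poly q z + poly (root_poly xs) z * r z) \<and>
    matrix_fun \<Gamma> h M = poly_mat q M"
proof -
  have sub: "spectrum M \<subseteq> \<Omega>" by (rule encloses_spectrum_subset[OF assms(1,2,4)])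
  obtain q r where qr: "r holomorphic_on \<Omega>" "\<And>z. h z = poly q z + poly (root_poly xs) z * r z"
    using hermite_interpolation[OF assms(3,1), of xs] sub assms(5) by metis
  have "matrix_fun \<Gamma> h M = poly_mat q M"
    using assms(1) sub holomorphic_on_imp_continuous_on[OF qr(1)] qr(2)
    by (rule matrix_fun_eq_poly_mat[OF assms])
  then show ?thesis using qr by blast
qed

section \<open>Sums, products, constants and similarity\<close>

context
  fixes \<Omega> :: "complex set" and \<Gamma> :: "real \<Rightarrow> complex" and M :: "complex^'n^'n"
  assumes \<Omega>: "open \<Omega>" "simply_connected \<Omega>"
    and enc: "encloses_spectrum \<Gamma> \<Omega> (spectrum M)"
begin

lemma matrix_fun_add:
  assumes "f holomorphic_on \<Omega>" "g holomorphic_on \<Omega>"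
  shows "matrix_fun \<Gamma> (\<lambda>z. f z + g z) M = matrix_fun \<Gamma> f M + matrix_fun \<Gamma> g M"
proof -
  obtain xs where xs: "set xs = spectrum M" "poly_mat (root_poly xs) M = 0" by (rule annihilating_roots)
  obtain p r where p: "r holomorphic_on \<Omega>" "\<And>z. f z = poly p z + poly (root_poly xs) z * r z"
    "matrix_fun \<Gamma> f M = poly_mat p M" using matrix_fun_hermite[OF \<Omega> assms(1) enc xs] by blast
  obtain q s where q: "s holomorphic_on \<Omega>" "\<And>z. g z = poly q z + poly (root_poly xs) z * s z"
    "matrix_fun \<Gamma> g M = poly_mat q M" using matrix_fun_hermite[OF \<Omega> assms(2) enc xs] by blast
  have "matrix_fun \<Gamma> (\<lambda>z. f z + g z) M = poly_mat (p + q) M"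
  proof (rule matrix_fun_eq_poly_mat[OF \<Omega> _ enc xs \<Omega>(1) encloses_spectrum_subset[OF \<Omega> enc]])
    show "continuous_on \<Omega> (\<lambda>z. r z + s z)"
      using p(1) q(1) by (intro continuous_intros holomorphic_on_imp_continuous_on)
    show "f z + g z = poly (p + q) z + poly (root_poly xs) z * (r z + s z)" for z
      by (simp add: p(2) q(2) algebra_simps)
  qed (use assms in \<open>auto intro!: holomorphic_intros\<close>)
  then show ?thesis by (simp add: poly_mat_add p q)
qed

lemma matrix_fun_mult:
  assumes "f holomorphic_on \<Omega>" "g holomorphic_on \<Omega>"
  shows "matrix_fun \<Gamma> (\<lambda>z. f z * g z) M = matrix_fun \<Gamma> f M ** matrix_fun \<Gamma> g M"
proof -
  obtain xs where xs: "set xs = spectrum M" "poly_mat (root_poly xs) M = 0" by (rule annihilating_roots)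
  obtain p r where p: "r holomorphic_on \<Omega>" "\<And>z. f z = poly p z + poly (root_poly xs) z * r z"
    "matrix_fun \<Gamma> f M = poly_mat p M" using matrix_fun_hermite[OF \<Omega> assms(1) enc xs] by blast
  obtain q s where q: "s holomorphic_on \<Omega>" "\<And>z. g z = poly q z + poly (root_poly xs) z * s z"
    "matrix_fun \<Gamma> g M = poly_mat q M" using matrix_fun_hermite[OF \<Omega> assms(2) enc xs] by blast
  have "matrix_fun \<Gamma> (\<lambda>z. f z * g z) M = poly_mat (p * q) M"
  proof (rule matrix_fun_eq_poly_mat[OF \<Omega> _ enc xs \<Omega>(1) encloses_spectrum_subset[OF \<Omega> enc]])
    \<comment> \<open>The cofactor stems from
      \<open>f g - p q = (f - p) g + p (g - q)\<close>.\<close>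
    show "continuous_on \<Omega> (\<lambda>z. r z * g z + poly p z * s z)"
      using p(1) q(1) assms by (intro continuous_intros holomorphic_on_imp_continuous_on)
    show "f z * g z = poly (p * q) z + poly (root_poly xs) z * (r z * g z + poly p z * s z)" for z
      by (simp add: p(2) q(2) algebra_simps)
  qed (use assms in \<open>auto intro!: holomorphic_intros\<close>)
  then show ?thesis by (simp add: poly_mat_mult p q)
qed

lemma matrix_fun_const:
  assumes "\<And>z. z \<in> \<Omega> \<Longrightarrow> f z = c"
  shows "matrix_fun \<Gamma> f M = mat c"
proof -
  obtain xs where xs: "set xs = spectrum M" "poly_mat (root_poly xs) M = 0" by (rule annihilating_roots)
  have "matrix_fun \<Gamma> f M = poly_mat [:c:] M"
  proof (rule matrix_fun_eq_poly_mat[OF \<Omega> _ enc xs \<Omega>(1) encloses_spectrum_subset[OF \<Omega> enc]])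
    show "f holomorphic_on \<Omega>"
      by (rule holomorphic_transform[of "\<lambda>z. c"]) (auto simp: assms)
    show "f z = poly [:c:] z + poly (root_poly xs) z * (\<lambda>z. 0) z" if "z \<in> \<Omega>" for z
      using assms[OF that] by simp
  qed simp
  then show ?thesis by simp
qed

text \<open>Similar matrices share the annihilating list, so one interpolant serves both, and
  conjugation commutes with polynomials.\<close>

lemma matrix_fun_similar:
  fixes P Q :: "complex^'n^'n"
  assumes "f holomorphic_on \<Omega>" and PQ: "P ** Q = mat 1" "Q ** P = mat 1"
    and same: "spectrum (P ** M ** Q) = spectrum M"
  shows "matrix_fun \<Gamma> f (P ** M ** Q) = P ** matrix_fun \<Gamma> f M ** Q"
proof -
  obtain xs where xs: "set xs = spectrum M" "poly_mat (root_poly xs) M = 0" by (rule annihilating_roots)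
  obtain p r where p: "r holomorphic_on \<Omega>" "\<And>z. f z = poly p z + poly (root_poly xs) z * r z"
    "matrix_fun \<Gamma> f M = poly_mat p M" using matrix_fun_hermite[OF \<Omega> assms(1) enc xs] by blast
  have "matrix_fun \<Gamma> f (P ** M ** Q) = poly_mat p (P ** M ** Q)"
  proof (rule matrix_fun_eq_poly_mat[OF \<Omega> assms(1)])
    show "continuous_on \<Omega> r" using p(1) by (rule holomorphic_on_imp_continuous_on)
    show "poly_mat (root_poly xs) (P ** M ** Q) = 0" by (simp add: poly_mat_similar[OF PQ] xs(2))
    show "spectrum (P ** M ** Q) \<subseteq> \<Omega>" using encloses_spectrum_subset[OF \<Omega> enc] same by simp
    show "f z = poly p z + poly (root_poly xs) z * r z" for z by (rule p(2))
  qed (use \<Omega> xs enc same in auto)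
  then show ?thesis by (simp add: poly_mat_similar[OF PQ] p(3))
qed

end

section \<open>Spectra of similar matrices\<close>

lemma spectrum_similar_subset:
  fixes M P Q :: "complex^'n^'n"
  assumes "Q ** P = mat 1"
  shows "spectrum (P ** M ** Q) \<subseteq> spectrum M"
proof
  fix z assume "z \<in> spectrum (P ** M ** Q)"
  then obtain v where v: "v \<noteq> 0" "(P ** M ** Q) *v v = z *s v" unfolding spectrum_def by blast
  have "M *v (Q *v v) = (Q ** P) *v (M *v (Q *v v))" using assms by simp
  also have "\<dots> = Q *v ((P ** M ** Q) *v v)" by (simp add: matrix_vector_mul_assoc matrix_mul_assoc)
  also have "\<dots> = z *s (Q *v v)" by (simp add: v(2) matrix_vector_mul_smult)
  finally have "M *v (Q *v v) = z *s (Q *v v)" .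
  moreover have "Q *v v \<noteq> 0"
  proof
    assume "Q *v v = 0"
    moreover have "P ** Q = mat 1" using assms matrix_left_right_inverse by blast
    then have "v = P *v (Q *v v)" by (simp add: matrix_vector_mul_assoc)
    ultimately show False using v(1) by simp
  qed
  ultimately show "z \<in> spectrum M" unfolding spectrum_def by blast
qed

lemma spectrum_similar:
  fixes M P Q :: "complex^'n^'n"
  assumes "P ** Q = mat 1" "Q ** P = mat 1"
  shows "spectrum (P ** M ** Q) = spectrum M"
proof
  have "Q ** (P ** M ** Q) ** P = (Q ** P) ** M ** (Q ** P)" by (simp only: matrix_mul_assoc)
  then have "Q ** (P ** M ** Q) ** P = M" by (simp add: assms)
  then show "spectrum M \<subseteq> spectrum (P ** M ** Q)"
    using spectrum_similar_subset[OF assms(1), of "P ** M ** Q"] by simp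
qed (rule spectrum_similar_subset[OF assms(2)])

section \<open>Interpolation of a composition\<close>

lemma poly_difference_factor:
  fixes u v :: "complex \<Rightarrow> complex"
  assumes "continuous_on V u" "continuous_on V v"
  shows "\<exists>t. continuous_on V t \<and> (\<forall>z. poly q (u z) - poly q (v z) = (u z - v z) * t z)"
proof (induction q)
  case 0
  show ?case by (intro exI[of _ "\<lambda>z. 0"]) auto
next
  case (pCons a q)
  then obtain t where t: "continuous_on V t" "\<And>z. poly q (u z) - poly q (v z) = (u z - v z) * t z" by blast
  \<comment> \<open>Horner's recursion for the cofactor of \<open>u - v\<close>. Later
    \<open>u\<close> is \<open>g\<close> and \<open>v\<close> its interpolant, so the error of
    \<open>g\<close> turns into an error of \<open>p \<circ> g\<close> divisible by the same
    polynomial.\<close>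
  have "poly (pCons a q) (u z) - poly (pCons a q) (v z) = (u z - v z) * (poly q (u z) + v z * t z)" for z
  proof -
    have "poly (pCons a q) (u z) - poly (pCons a q) (v z) =
        (u z - v z) * poly q (u z) + v z * (poly q (u z) - poly q (v z))"
      by (simp add: algebra_simps)
    then show ?thesis by (simp add: t(2) algebra_simps)
  qed
  then show ?case
    using assms t(1) by (intro exI[of _ "\<lambda>z. poly q (u z) + v z * t z"]) (auto intro!: continuous_intros)
qed

text \<open>Each factor \<open>g z - g x\<close> is divisible by \<open>z - x\<close>; taking the
  product over the list keeps the multiplicities.\<close>

lemma root_poly_map_factor:
  assumes "g holomorphic_on \<Omega>" "open \<Omega>" "set xs \<subseteq> \<Omega>"
  shows "\<exists>t. t holomorphic_on \<Omega> \<and> (\<forall>z. poly (root_poly (map g xs)) (g z) = poly (root_poly xs) z * t z)"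
  using assms(3)
proof (induction xs)
  case Nil
  show ?case by (intro exI[of _ "\<lambda>z. 1"]) auto
next
  case (Cons x xs)
  then obtain t where t: "t holomorphic_on \<Omega>"
    "\<And>z. poly (root_poly (map g xs)) (g z) = poly (root_poly xs) z * t z" by auto
  obtain k where k: "k holomorphic_on \<Omega>" "\<And>z. g z = g x + (z - x) * k z"
    using difference_quotient[OF assms(1,2), of x] Cons.prems by auto
  have "poly (root_poly (map g (x # xs))) (g z) = poly (root_poly (x # xs)) z * (k z * t z)" for z
  proof -
    have "g z - g x = (z - x) * k z" by (subst k(2)) simp
    moreover have "poly (root_poly (map g (x # xs))) (g z) = (g z - g x) * (poly (root_poly xs) z * t z)"
      by (simp add: t(2) algebra_simps)
    ultimately have "poly (root_poly (map g (x # xs))) (g z) =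
        (z - x) * k z * (poly (root_poly xs) z * t z)" by metis
    then show ?thesis by (simp add: algebra_simps)
  qed
  then show ?case using t(1) k(1) by (intro exI[of _ "\<lambda>z. k z * t z"]) (auto intro!: holomorphic_intros)
qed

text \<open>Since \<open>x\<close> is a root of \<open>q - q(x)\<close>, every linear factor divides
  its counterpart. Hence the image list annihilates \<open>poly_mat q M\<close> whenever
  \<open>xs\<close> annihilates \<open>M\<close>.\<close>

lemma root_poly_dvd_pcompose:
  "root_poly xs dvd pcompose (root_poly (map (poly q) xs)) q" for q :: "complex poly"
proof (induction xs)
  case (Cons x xs)
  have "[:- x, 1:] dvd pcompose [:- poly q x, 1:] q"
    by (simp add: poly_eq_0_iff_dvd[symmetric] poly_pcompose)
  then show ?case
    unfolding list.map root_poly_simps pcompose_mult by (rule mult_dvd_mono[OF _ Cons.IH])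
qed simp

text \<open>If \<open>x\<^sub>1, \<dots>, x\<^sub>k\<close> are the roots (with multiplicities) of an annihilating polynomial of \<open>M\<close>,
  then \<open>g x\<^sub>1, \<dots>, g x\<^sub>k\<close> play this role for \<open>g M\<close>. Interpolating \<open>g\<close> at the former and \<open>f\<close> at the
  latter makes the composition of the interpolants an interpolant of \<open>f \<circ> g\<close>.\<close>

lemma matrix_fun_compose:
  fixes M :: "complex^'n^'n"
  assumes \<Omega>: "open \<Omega>" "simply_connected \<Omega>" and f: "f holomorphic_on \<Omega>" and g: "g holomorphic_on \<Omega>"
    and enc: "encloses_spectrum \<Gamma> \<Omega> (spectrum M)"
    and enc_g: "encloses_spectrum \<Gamma> \<Omega> (spectrum (matrix_fun \<Gamma> g M))"
    and \<Omega>': "open \<Omega>'" "simply_connected \<Omega>'" and fg: "(f \<circ> g) holomorphic_on \<Omega>'"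
    and enc': "encloses_spectrum \<Gamma>' \<Omega>' (spectrum M)"
  shows "matrix_fun \<Gamma>' (f \<circ> g) M = matrix_fun \<Gamma> f (matrix_fun \<Gamma> g M)"
proof -
  define W where "W = matrix_fun \<Gamma> g M"
  obtain xs where xs: "set xs = spectrum M" "poly_mat (root_poly xs) M = 0" by (rule annihilating_roots)
  have xs_in: "set xs \<subseteq> \<Omega>" using encloses_spectrum_subset[OF \<Omega> enc] xs(1) by simp
  obtain q r where q: "r holomorphic_on \<Omega>" "\<And>z. g z = poly q z + poly (root_poly xs) z * r z"
    "W = poly_mat q M" using matrix_fun_hermite[OF \<Omega> g enc xs, folded W_def] by blast
  have gq: "g x = poly q x" if "x \<in> set xs" for x using q(2)[of x] that by simp
  define ys where "ys = map g xs"
  have ys_q: "ys = map (poly q) xs" using gq by (simp add: ys_def)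
  have "poly_mat (root_poly ys) W = poly_mat (pcompose (root_poly ys) q) M"
    by (simp add: poly_mat_pcompose q(3))
  also have "\<dots> = 0"
    using root_poly_dvd_pcompose[of xs q] xs(2) by (auto simp: ys_q poly_mat_mult elim: dvdE)
  finally have ys0: "poly_mat (root_poly ys) W = 0" .
  \<comment> \<open>Spectral mapping: one inclusion follows from eigenvectors of \<open>M\<close>,
    the other from the annihilating polynomial of \<open>W\<close>.\<close>
  have ys: "set ys = spectrum W"
  proof
    show "set ys \<subseteq> spectrum W" using spectral_inclusion[of _ M q] xs(1) by (auto simp: ys_q q(3))
    show "spectrum W \<subseteq> set ys" using spectrum_subset_roots[OF ys0] by auto
  qed
  obtain p s where p: "s holomorphic_on \<Omega>" "\<And>z. f z = poly p z + poly (root_poly ys) z * s z"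
    "matrix_fun \<Gamma> f W = poly_mat p W"
    using matrix_fun_hermite[OF \<Omega> f enc_g[folded W_def] ys ys0] by blast
  \<comment> \<open>The cofactor \<open>s\<close> of \<open>f\<close> is continuous on \<Omega>
    only, so \<open>s (g z)\<close> is controlled where \<open>g\<close> maps into \<Omega>. This
    open set contains the spectrum of \<open>M\<close> because \<open>g\<close> sends the latter to
    the spectrum of \<open>W\<close>.\<close>
  define V where "V = \<Omega> \<inter> g -` \<Omega>"
  have g_cont: "continuous_on \<Omega> g" using g by (rule holomorphic_on_imp_continuous_on)
  have V: "open V" unfolding V_def using continuous_open_preimage[OF g_cont \<Omega>(1) \<Omega>(1)] .
  have V_sub: "V \<subseteq> \<Omega>" by (auto simp: V_def)
  have "set ys \<subseteq> \<Omega>" using encloses_spectrum_subset[OF \<Omega> enc_g] ys by (simp add: W_def)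
  then have spec_V: "spectrum M \<subseteq> V" using xs xs_in by (auto simp: V_def ys_def)
  obtain t where t: "continuous_on V t" "\<And>z. poly p (g z) - poly p (poly q z) = (g z - poly q z) * t z"
    using poly_difference_factor[OF continuous_on_subset[OF g_cont V_sub]
        continuous_on_poly[OF continuous_on_id]] by blast
  obtain k where k: "k holomorphic_on \<Omega>" "\<And>z. poly (root_poly ys) (g z) = poly (root_poly xs) z * k z"
    using root_poly_map_factor[OF g \<Omega>(1) xs_in] unfolding ys_def by blast
  have "matrix_fun \<Gamma>' (f \<circ> g) M = poly_mat (pcompose p q) M"
  proof (rule matrix_fun_eq_poly_mat[OF \<Omega>' fg enc' xs V spec_V])
    have "continuous_on V (\<lambda>z. s (g z))"
      by (rule continuous_on_compose2[OF holomorphic_on_imp_continuous_on[OF p(1)]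
            continuous_on_subset[OF g_cont V_sub]]) (auto simp: V_def)
    moreover have "continuous_on V r" "continuous_on V k"
      using q(1) k(1) V_sub holomorphic_on_imp_continuous_on continuous_on_subset by blast+
    ultimately show "continuous_on V (\<lambda>z. r z * t z + k z * s (g z))"
      using t(1) by (intro continuous_intros)
    fix z
    have "g z - poly q z = poly (root_poly xs) z * r z" using q(2)[of z] by simp
    then have "poly p (g z) = poly p (poly q z) + poly (root_poly xs) z * r z * t z"
      using t(2)[of z] by (simp add: algebra_simps)
    \<comment> \<open>The first summand of the cofactor is the error of replacing \<open>g\<close>
      by \<open>q\<close> inside \<open>p\<close>, the second the error of replacing
      \<open>f\<close> by \<open>p\<close> at \<open>g z\<close>.\<close>
    then show "(f \<circ> g) z = poly (pcompose p q) z + poly (root_poly xs) z * (r z * t z + k z * s (g z))"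
      using p(2)[of "g z"] k(2)[of z] by (simp add: poly_pcompose algebra_simps)
  qed
  then show ?thesis using p(3) by (simp add: poly_mat_pcompose q(3) flip: W_def)
qed

text \<open>By the Jordan curve theorem the inside is connected, so the winding number is constant
  there; one point of \<open>S\<close> fixes its value as 1.\<close>

lemma encloses_spectrum_inside:
  assumes enc: "encloses_spectrum \<Gamma> \<Omega> S" and "S \<noteq> {}" "T \<subseteq> inside (path_image \<Gamma>)"
  shows "encloses_spectrum \<Gamma> \<Omega> T"
proof -
  have \<Gamma>: "simple_path \<Gamma>" "pathfinish \<Gamma> = pathstart \<Gamma>" "path \<Gamma>"
    using enc by (auto simp: encloses_spectrum_def simple_path_imp_path)
  have "connected (inside (path_image \<Gamma>))" using Jordan_inside_outside[OF \<Gamma>(1,2)] by simp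
  then obtain c where c: "\<And>z. z \<in> inside (path_image \<Gamma>) \<Longrightarrow> winding_number \<Gamma> z = c"
    using winding_number_constant[OF \<Gamma>(3,2), of "inside (path_image \<Gamma>)"] inside_no_overlap
    unfolding constant_on_def by blast
  obtain s where "s \<in> S" using assms(2) by blast
  then have "c = 1" using c[of s] enc unfolding encloses_spectrum_def by auto
  then show ?thesis using enc assms(3) c unfolding encloses_spectrum_def by auto
qed

section \<open>The Frechet derivative\<close>

lemma matrix_holomorphic_on_imp_continuous_on:
  assumes "matrix_holomorphic_on F U"
  shows "continuous_on U F"
proof -
  have "continuous_on U (\<lambda>z. \<chi> i j. F z $ i $ j)"
    using assms unfolding matrix_holomorphic_on_def
    by (intro continuous_on_vec_lambda holomorphic_on_imp_continuous_on) blast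
  then show ?thesis by simp
qed

lemma matrix_mult_bounded:
  obtains K where "K > 0"
    "\<And>(X :: complex^'n^'n) (Y :: complex^'n^'n). norm (X ** Y) \<le> K * norm X * norm Y"
proof -
  have "bilinear (\<lambda>(X :: complex^'n^'n) (Y :: complex^'n^'n). X ** Y)"
    unfolding bilinear_def
    by (auto intro!: linearI simp: matrix_add_ldistrib matrix_add_rdistrib matrix_scalar_ac scalar_matrix_assoc)
  then show ?thesis using bilinear_bounded_pos that by blast
qed

lemma matrix_vector_mult_bounded:
  obtains K where "K > 0"
    "\<And>(X :: complex^'n^'n) v. norm (X *v v) \<le> K * norm X * norm v"
proof -
  have "bilinear (\<lambda>(X :: complex^'n^'n) v. X *v v)"
    unfolding bilinear_def
    by (auto intro!: linearI simp: matrix_vector_mult_add_rdistrib matrix_vector_right_distrib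
        vec_eq_iff matrix_vector_mult_def scaleR_sum_right sum.distrib distrib_right)
  then show ?thesis using bilinear_bounded_pos that by blast
qed

lemma norm_matrix_le:
  fixes X :: "complex^'m^'n"
  assumes "\<And>i j. norm (X $ i $ j) \<le> b"
  shows "norm X \<le> real CARD('n) * (real CARD('m) * b)"
proof -
  have "norm (X $ i) \<le> real CARD('m) * b" for i
    using order_trans[OF L2_set_le_sum sum_bounded_above[of UNIV "\<lambda>j. norm (X $ i $ j)" b]] assms
    by (simp add: norm_vec_def)
  then show ?thesis
    using order_trans[OF L2_set_le_sum sum_bounded_above[of UNIV "\<lambda>i. norm (X $ i)"]]
    by (simp add: norm_vec_def[of X])
qed

text \<open>The second resolvent identity, from writing \<open>z - A\<close> as
  \<open>(z - (A + E)) + E\<close> between the two inverses.\<close>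

lemma resolvent_perturbation:
  assumes "z \<notin> spectrum A" "z \<notin> spectrum (A + E)"
  shows "matrix_inv (mat z - (A + E)) =
    matrix_inv (mat z - A) + matrix_inv (mat z - A) ** E ** matrix_inv (mat z - (A + E))"
    (is "?R' = ?R + ?R ** E ** ?R'")
proof -
  have "?R' = ?R ** (mat z - A) ** ?R'" using resolvent_left_inverse[OF assms(1)] by simp
  also have "\<dots> = ?R ** ((mat z - (A + E)) ** ?R' + E ** ?R')"
    by (simp add: matrix_mul_assoc[symmetric] matrix_add_rdistrib[symmetric])
  also have "\<dots> = ?R + ?R ** E ** ?R'"
    by (simp add: resolvent_right_inverse[OF assms(2)] matrix_add_ldistrib matrix_mul_assoc)
  finally show ?thesis .
qed

text \<open>An eigenvector of \<open>A + E\<close> for \<open>z\<close> would be a fixed vector of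
  \<open>(z - A)^-1 E\<close>, which is a contraction by the last hypothesis.\<close>

lemma notin_spectrum_perturbation:
  fixes A E :: "complex^'n^'n"
  assumes K: "\<And>(X :: complex^'n^'n) v. norm (X *v v) \<le> K * norm X * norm v"
    and z: "z \<notin> spectrum A" and "K * norm (matrix_inv (mat z - A) ** E) < 1"
  shows "z \<notin> spectrum (A + E)"
proof
  assume "z \<in> spectrum (A + E)"
  then obtain v where v: "v \<noteq> 0" "(A + E) *v v = z *s v" unfolding spectrum_def by blast
  have "(mat z - A) *v v = E *v v"
    using v(2) by (simp add: matrix_vector_mult_add_rdistrib matrix_vector_mult_diff_rdistrib algebra_simps)
  then have "matrix_inv (mat z - A) *v ((mat z - A) *v v) = (matrix_inv (mat z - A) ** E) *v v"
    by (simp add: matrix_vector_mul_assoc[symmetric])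
  then have "v = (matrix_inv (mat z - A) ** E) *v v"
    by (simp add: matrix_vector_mul_assoc resolvent_left_inverse[OF z])
  then have "norm v \<le> K * norm (matrix_inv (mat z - A) ** E) * norm v" using K by metis
  also have "\<dots> < 1 * norm v" using assms(3) v(1) by (intro mult_strict_right_mono) auto
  finally show False by simp
qed

lemma has_derivative_of_quadratic_bound:
  fixes F :: "'a::real_normed_vector \<Rightarrow> 'b::real_normed_vector"
  assumes "bounded_linear L" "\<eta> > 0"
    and "\<And>h. norm h < \<eta> \<Longrightarrow> norm (F (x + h) - F x - L h) \<le> T * (norm h)\<^sup>2"
  shows "(F has_derivative L) (at x)"
  unfolding has_derivative_at
proof (intro conjI assms(1))
  show "(\<lambda>h. norm (F (x + h) - F x - L h) / norm h) \<midarrow>0\<rightarrow> 0"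
  proof (rule Lim_null_comparison)
    have "norm (norm (F (x + h) - F x - L h) / norm h) \<le> T * norm h"
      if "h \<noteq> 0" "norm h < \<eta>" for h
      using assms(3)[OF that(2)] that(1) by (simp add: divide_le_eq power2_eq_square)
    then show "\<forall>\<^sub>F h in at 0. norm (norm (F (x + h) - F x - L h) / norm h) \<le> T * norm h"
      unfolding eventually_at using assms(2) by (intro exI[of _ \<eta>]) auto
    show "((\<lambda>h. T * norm h) \<longlongrightarrow> 0) (at 0)"
      using tendsto_mult_right_zero[OF tendsto_norm_zero[OF tendsto_ident_at]] .
  qed
qed

text \<open>One valid path replaces \<open>\<Gamma>\<close> for all small perturbations at once: on a compact neighbourhood
  of \<open>\<Gamma>\<close> the resolvent \<open>R\<close> of \<open>A\<close> is bounded, so the resolvent \<open>R'\<close> of \<open>A + E\<close> exists and is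
  bounded there, and \<open>R' - R - R E R = R E R E R'\<close>.\<close>

lemma Frechet_derivative_matrix_fun:
  fixes A :: "complex^'n^'n"
  assumes "open \<Omega>" and f: "f holomorphic_on \<Omega>" and enc: "encloses_spectrum \<Gamma> \<Omega> (spectrum A)"
  shows "is_Frechet_derivative (matrix_fun \<Gamma> f) A (D_op \<Gamma> f A A)"
proof -
  have \<Gamma>: "rectifiable_path \<Gamma>" "path \<Gamma>" "path_image \<Gamma> \<subseteq> \<Omega> - spectrum A"
    using enc encloses_spectrum_disjoint[OF enc]
    by (auto simp: encloses_spectrum_def rectifiable_path_def)
  have "open (\<Omega> - spectrum A)" using assms(1) finite_spectrum by (intro open_Diff finite_imp_closed)
  then obtain e where e: "e > 0" "(\<Union>x\<in>path_image \<Gamma>. cball x e) \<subseteq> \<Omega> - spectrum A"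
    "compact (\<Union>x\<in>path_image \<Gamma>. cball x e)"
    using compact_cball_neighbourhood[OF compact_path_image[OF \<Gamma>(2)] _ \<Gamma>(3)] by blast
  \<comment> \<open>The compact \<open>N\<close> provides bounds for the resolvent and for
    \<open>f\<close>; its open part \<open>U\<close> carries the new path and the holomorphic
    integrands.\<close>
  define N where "N = (\<Union>x\<in>path_image \<Gamma>. cball x e)"
  define U where "U = (\<Union>x\<in>path_image \<Gamma>. ball x e)"
  have N: "compact N" "N \<subseteq> \<Omega>" "N \<subseteq> - spectrum A"
    using e(2,3) unfolding N_def[symmetric] by blast+
  have "U \<subseteq> N" unfolding U_def N_def by (intro UN_mono ball_subset_cball order_refl)
  moreover have "open U" unfolding U_def by blast
  moreover have "path_image \<Gamma> \<subseteq> U" unfolding U_def using e(1) by (meson UN_I centre_in_ball subsetI)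
  ultimately have U: "open U" "path_image \<Gamma> \<subseteq> U" "U \<subseteq> N" "U \<subseteq> \<Omega>" "U \<inter> spectrum A = {}"
    using N by blast+
  obtain p where p: "valid_path p" "path_image p \<subseteq> U"
    "\<And>F. F holomorphic_on U \<Longrightarrow> has_line_integral F (contour_integral p F) \<Gamma>"
    using valid_path_approximation[OF \<Gamma>(1) U(1,2)] by metis
  interpret contour_in p U by unfold_locales (use p U in auto)
  have line: "matrix_line_integral \<Gamma> F = matrix_contour_integral p F" if "matrix_holomorphic_on F U"
    for F :: "complex \<Rightarrow> complex^'n^'n"
    using that p(3) unfolding matrix_holomorphic_on_def
    by (intro matrix_eqI) (simp add: matrix_line_integral_def line_integral_eqI)
  define R where "R z = matrix_inv (mat z - A)" for z
  define c :: complex where "c = 1 / (2 * of_real pi * \<i>)"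
  have hR: "matrix_holomorphic_on R U" and hRN: "matrix_holomorphic_on R N"
    unfolding R_def using resolvent_holomorphic U(5) N(3) by (blast intro: matrix_holomorphic_on_subset)+
  have hf: "f holomorphic_on U" and hfN: "f holomorphic_on N"
    using f U(4) N(2) by (blast intro: holomorphic_on_subset)+
  have hD: "matrix_holomorphic_on (\<lambda>z. mat (f z) ** R z ** E ** R z) U" for E
    by (intro matrix_holomorphic_on_mult matrix_holomorphic_on_mat hf hR matrix_holomorphic_on_const)
  have D: "D_op \<Gamma> f A A E = mat c ** matrix_contour_integral p (\<lambda>z. mat (f z) ** R z ** E ** R z)" for E
    unfolding D_op_def R_def[symmetric] c_def by (simp add: line[OF hD])
  have D_mat: "D_op \<Gamma> f A A (mat a ** E) = mat a ** D_op \<Gamma> f A A E" for a E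
  proof -
    have eq: "mat (f z) ** R z ** (mat a ** E) ** R z = mat a ** (mat (f z) ** R z ** E ** R z)" for z
      by (simp add: mat_mul_commute[of "mat (f z) ** R z"] matrix_mul_assoc)
    show ?thesis
      unfolding D eq matrix_contour_integral_lmul[OF hD] by (rule mat_mul_left_commute)
  qed
  have "linear (D_op \<Gamma> f A A)"
  proof (rule linearI)
    fix E E' :: "complex^'n^'n" and r :: real
    show "D_op \<Gamma> f A A (E + E') = D_op \<Gamma> f A A E + D_op \<Gamma> f A A E'"
      unfolding D using matrix_contour_integral_add[OF hD[of E] hD[of E']]
      by (simp add: matrix_add_ldistrib matrix_add_rdistrib)
    show "D_op \<Gamma> f A A (r *\<^sub>R E) = r *\<^sub>R D_op \<Gamma> f A A E"
      using D_mat[of "of_real r" E] by (simp add: mat_of_real_mul)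
  qed
  then have lin: "bounded_linear (D_op \<Gamma> f A A)" by (simp add: linear_conv_bounded_linear)

  \<comment> \<open>\<open>L\<close> depends on the path alone, so it serves every perturbation
    \<open>E\<close>.\<close>
  obtain L where L: "L > 0"
    "\<And>F B. F holomorphic_on U \<Longrightarrow> (\<And>z. z \<in> U \<Longrightarrow> norm (F z) \<le> B) \<Longrightarrow> norm (contour_integral p F) \<le> L * B"
    using contour_integral_bound_exists[OF U(1) p(1,2)] by blast
  obtain C where C: "C > 0" "\<And>z. z \<in> N \<Longrightarrow> norm (R z) \<le> C"
    using compact_imp_bounded[OF compact_continuous_image[OF matrix_holomorphic_on_imp_continuous_on[OF hRN] N(1)]]
    unfolding bounded_pos by blast
  obtain m where m: "m > 0" "\<And>z. z \<in> N \<Longrightarrow> norm (f z) \<le> m"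
    using compact_imp_bounded[OF compact_continuous_image[OF holomorphic_on_imp_continuous_on[OF hfN] N(1)]]
    unfolding bounded_pos by blast
  obtain K where K: "K > 0" "\<And>(X :: complex^'n^'n) (Y :: complex^'n^'n). norm (X ** Y) \<le> K * norm X * norm Y"
    using matrix_mult_bounded[where 'n = 'n] by metis
  obtain K' where K': "K' > 0" "\<And>(X :: complex^'n^'n) v. norm (X *v v) \<le> K' * norm X * norm v"
    using matrix_vector_mult_bounded[where 'n = 'n] by metis
  \<comment> \<open>The first bound keeps the spectrum of \<open>A + E\<close> away from
    \<open>U\<close>; the second makes \<open>K * norm (R z ** E)\<close> at most 1/2, which bounds
    the perturbed resolvent.\<close>
  define \<eta> where "\<eta> = min (1 / (K' * K * C)) (1 / (2 * K * K * C))"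
  have "\<eta> > 0" using K K' C by (simp add: \<eta>_def)
  \<comment> \<open>The remainder \<open>R E R E R'\<close> involves four products, each costing
    \<open>K\<close>, and three resolvents, bounded by \<open>C\<close>, \<open>C\<close> and
    \<open>2 * C\<close>; \<open>m\<close> bounds \<open>f\<close>. The two factors \<open>d\<close>
    below pass from entries to the matrix norm.\<close>
  define T where "T = norm c * (L * (m * (2 * K ^ 4 * C ^ 3)))"
  define d where "d = real CARD('n)"
  have "norm (matrix_fun \<Gamma> f (A + E) - matrix_fun \<Gamma> f A - D_op \<Gamma> f A A E)
      \<le> d * (d * (T * (norm E)\<^sup>2))" if "norm E < \<eta>" for E
  proof -
    define R' where "R' z = matrix_inv (mat z - (A + E))" for z
    have RE: "norm (R z ** E) \<le> K * C * norm E" if "z \<in> U" for z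
    proof -
      have "norm (R z ** E) \<le> K * norm (R z) * norm E" by (rule K(2))
      also have "\<dots> \<le> K * C * norm E"
        using C(2)[of z] that U(3) K(1) by (intro mult_right_mono mult_left_mono) auto
      finally show ?thesis .
    qed
    have E: "K' * (K * C * norm E) < 1" "K * (K * C * norm E) \<le> 1 / 2"
      using that K(1) K'(1) C(1) by (auto simp: \<eta>_def field_simps)
    have spec: "z \<notin> spectrum A" "z \<notin> spectrum (A + E)" if "z \<in> U" for z
    proof -
      show z: "z \<notin> spectrum A" using that U(5) by auto
      show "z \<notin> spectrum (A + E)"
      proof (rule notin_spectrum_perturbation[OF K'(2) z])
        have "K' * norm (R z ** E) \<le> K' * (K * C * norm E)"
          using RE[OF that] K'(1) by (intro mult_left_mono) auto
        then show "K' * norm (matrix_inv (mat z - A) ** E) < 1" using E(1) by (simp add: R_def)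
      qed
    qed
    have R'_eq: "R' z = R z + R z ** E ** R' z" if "z \<in> U" for z
      unfolding R_def R'_def by (rule resolvent_perturbation[OF spec[OF that]])
    have R'_le: "norm (R' z) \<le> 2 * C" if "z \<in> U" for z
    proof -
      have "norm (R' z) \<le> norm (R z) + norm (R z ** E ** R' z)"
        using norm_triangle_ineq R'_eq[OF that] by metis
      also have "norm (R z ** E ** R' z) \<le> K * norm (R z ** E) * norm (R' z)" by (rule K(2))
      also have "K * norm (R z ** E) * norm (R' z) \<le> K * (K * C * norm E) * norm (R' z)"
        using RE[OF that] K(1) by (intro mult_right_mono mult_left_mono) auto
      \<comment> \<open>Half of the norm of \<open>R' z\<close> is absorbed on the left, which
        doubles the bound \<open>C\<close>.\<close>
      also have "\<dots> \<le> 1 / 2 * norm (R' z)" using E(2) by (intro mult_right_mono) auto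
      finally show ?thesis using C(2)[of z] that U(3) by auto
    qed
    define G where "G z = mat (f z) ** R' z - mat (f z) ** R z - mat (f z) ** R z ** E ** R z" for z
    have G_eq: "G z = mat (f z) ** (R z ** E ** (R z ** E ** R' z))" if "z \<in> U" for z
    proof -
      have diff: "R' z - R z = R z ** E ** R' z" using R'_eq[OF that] by (metis add_diff_cancel_left')
      have "R z ** E ** (R z ** E ** R' z) = R z ** E ** (R' z - R z)" by (simp only: diff)
      also have "\<dots> = R' z - R z - R z ** E ** R z"
        by (simp only: matrix_diff_ldistrib diff[symmetric])
      finally show ?thesis by (simp add: G_def matrix_diff_ldistrib matrix_mul_assoc)
    qed
    have G_le: "norm (G z $ i $ j) \<le> m * (2 * K ^ 4 * C ^ 3 * (norm E)\<^sup>2)" if "z \<in> U" for z i j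
    proof -
      let ?X = "R z ** E ** (R z ** E ** R' z)"
      have "norm ?X \<le> K * norm (R z ** E) * norm (R z ** E ** R' z)" by (rule K(2))
      also have "\<dots> \<le> K * (K * C * norm E) * (K * (K * C * norm E) * (2 * C))"
      proof (rule mult_mono)
        show "K * norm (R z ** E) \<le> K * (K * C * norm E)"
          using RE[OF that] K(1) by (intro mult_left_mono) auto
        have "norm (R z ** E ** R' z) \<le> K * norm (R z ** E) * norm (R' z)" by (rule K(2))
        also have "\<dots> \<le> K * (K * C * norm E) * (2 * C)"
          using RE[OF that] R'_le[OF that] K(1) C(1) by (intro mult_mono) auto
        finally show "norm (R z ** E ** R' z) \<le> K * (K * C * norm E) * (2 * C)" .
      qed (use K(1) C(1) in auto)
      also have "\<dots> = 2 * K ^ 4 * C ^ 3 * (norm E)\<^sup>2"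
        by (simp add: power2_eq_square power3_eq_cube power4_eq_xxxx algebra_simps)
      finally have X: "norm ?X \<le> 2 * K ^ 4 * C ^ 3 * (norm E)\<^sup>2" .
      have "norm (?X $ i $ j) \<le> norm ?X"
        using order_trans[OF Finite_Cartesian_Product.norm_nth_le Finite_Cartesian_Product.norm_nth_le] by blast
      then have "norm (f z) * norm (?X $ i $ j) \<le> m * (2 * K ^ 4 * C ^ 3 * (norm E)\<^sup>2)"
        using X m(2)[of z] m(1) that U(3) by (intro mult_mono) auto
      then show ?thesis by (simp add: G_eq[OF that] norm_mult)
    qed
    have hR': "matrix_holomorphic_on R' U"
      unfolding R'_def using spec(2) by (blast intro: matrix_holomorphic_on_subset[OF resolvent_holomorphic])
    have h1: "matrix_holomorphic_on (\<lambda>z. mat (f z) ** R' z) U"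
      and h2: "matrix_holomorphic_on (\<lambda>z. mat (f z) ** R z) U"
      by (intro matrix_holomorphic_on_mult matrix_holomorphic_on_mat hf hR hR')+
    have hG: "matrix_holomorphic_on G U"
      unfolding G_def by (intro matrix_holomorphic_on_diff h1 h2 hD)
    have "matrix_fun \<Gamma> f (A + E) - matrix_fun \<Gamma> f A - D_op \<Gamma> f A A E
        = mat c ** matrix_contour_integral p G"
      unfolding matrix_fun_def D R_def[symmetric] R'_def[symmetric] c_def[symmetric] line[OF h1] line[OF h2]
      unfolding G_def matrix_contour_integral_diff[OF matrix_holomorphic_on_diff[OF h1 h2] hD]
        matrix_contour_integral_diff[OF h1 h2] matrix_diff_ldistrib ..
    moreover have "norm ((mat c ** matrix_contour_integral p G) $ i $ j) \<le> T * (norm E)\<^sup>2" for i j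
    proof -
      have "norm (contour_integral p (\<lambda>z. G z $ i $ j)) \<le> L * (m * (2 * K ^ 4 * C ^ 3 * (norm E)\<^sup>2))"
        using hG G_le unfolding matrix_holomorphic_on_def by (intro L(2)) auto
      then have "norm c * norm (contour_integral p (\<lambda>z. G z $ i $ j))
          \<le> norm c * (L * (m * (2 * K ^ 4 * C ^ 3 * (norm E)\<^sup>2)))"
        by (rule mult_left_mono) simp
      then show ?thesis by (simp add: norm_mult T_def mult.assoc)
    qed
    ultimately show ?thesis unfolding d_def by (metis norm_matrix_le)
  qed
  then have "(matrix_fun \<Gamma> f has_derivative D_op \<Gamma> f A A) (at A)"
    by (intro has_derivative_of_quadratic_bound[OF lin \<open>\<eta> > 0\<close>, of _ _ "d * (d * T)"])
      (simp add: mult.assoc)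
  then show ?thesis unfolding is_Frechet_derivative_def using D_mat by blast
qed

section \<open>The rules for the operator\<close>

theorem lemma1p2:
  fixes \<Omega> :: "complex set" and f g :: "complex \<Rightarrow> complex"
    and A :: "complex^'n^'n" and B :: "complex^'d^'d"
    and \<Gamma> :: "real \<Rightarrow> complex"
  assumes "open \<Omega>" and "simply_connected \<Omega>"
    and "f analytic_on \<Omega>" and "g analytic_on \<Omega>"
    and "spectrum A \<subseteq> \<Omega>" and "spectrum B \<subseteq> \<Omega>"
    and "encloses_spectrum \<Gamma> \<Omega> (spectrum A \<union> spectrum B)"
  shows
    "is_Frechet_derivative (matrix_fun \<Gamma> f) A (\<lambda>E. D_op \<Gamma> f A A E)
   \<and> (\<forall>(E::complex^'d^'n) (P1::complex^'n^'n) (T1::complex^'n^'n)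
          (P2::complex^'d^'d) (T2::complex^'d^'d).
        invertible P1 \<and> invertible P2 \<and>
        A = P1 ** T1 ** matrix_inv P1 \<and> B = P2 ** T2 ** matrix_inv P2 \<longrightarrow>
        D_op \<Gamma> f A B E = P1 ** D_op \<Gamma> f T1 T2 (matrix_inv P1 ** E ** P2) ** matrix_inv P2)
   \<and> (f constant_on \<Omega> \<longrightarrow> (\<forall>E::complex^'d^'n. D_op \<Gamma> f A B E = 0))
   \<and> (\<forall>E::complex^'d^'n.
        D_op \<Gamma> (\<lambda>z. f z + g z) A B E = D_op \<Gamma> f A B E + D_op \<Gamma> g A B E)
   \<and> (\<forall>E::complex^'d^'n.
        D_op \<Gamma> (\<lambda>z. f z * g z) A B E =
          matrix_fun \<Gamma> f A ** D_op \<Gamma> g A B E + D_op \<Gamma> f A B E ** matrix_fun \<Gamma> g B)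
   \<and> (spectrum (matrix_fun \<Gamma> g A) \<union> spectrum (matrix_fun \<Gamma> g B) \<subseteq> inside (path_image \<Gamma>) \<longrightarrow>
        (\<forall>\<Omega>' \<Gamma>'. open \<Omega>' \<and> simply_connected \<Omega>' \<and> (f \<circ> g) analytic_on \<Omega>' \<and>
           encloses_spectrum \<Gamma>' \<Omega>' (spectrum A \<union> spectrum B) \<longrightarrow>
           (\<forall>E::complex^'d^'n.
              D_op \<Gamma>' (f \<circ> g) A B E =
                D_op \<Gamma> f (matrix_fun \<Gamma> g A) (matrix_fun \<Gamma> g B) (D_op \<Gamma> g A B E))))"
proof -
  note \<Omega> = assms(1,2) and enc = assms(7)
  have f: "f holomorphic_on \<Omega>" and g: "g holomorphic_on \<Omega>"
    using assms(3,4) analytic_imp_holomorphic by auto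
  have disj: "path_image \<Gamma> \<inter> (spectrum A \<union> spectrum B) = {}"
    by (rule encloses_spectrum_disjoint[OF enc])
  have enc_M: "encloses_spectrum \<Gamma> \<Omega> (spectrum (block_upper A E B))" for E
    using encloses_spectrum_mono[OF enc spectrum_block_upper] .
  note block = matrix_fun_block_upper[OF disj]

  have Frechet: "is_Frechet_derivative (matrix_fun \<Gamma> f) A (\<lambda>E. D_op \<Gamma> f A A E)"
    using Frechet_derivative_matrix_fun[OF \<Omega>(1) f encloses_spectrum_mono[OF enc Un_upper1]] .

  have similar: "D_op \<Gamma> f A B E = P1 ** D_op \<Gamma> f T1 T2 (matrix_inv P1 ** E ** P2) ** matrix_inv P2"
    if inv: "invertible P1" "invertible P2"
      and A: "A = P1 ** T1 ** matrix_inv P1" and B: "B = P2 ** T2 ** matrix_inv P2"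
    for E :: "complex^'d^'n" and P1 T1 :: "complex^'n^'n" and P2 T2 :: "complex^'d^'d"
  proof -
    let ?Q1 = "matrix_inv P1" and ?Q2 = "matrix_inv P2"
    \<comment> \<open>The corner that conjugation by the block diagonal matrix of \<open>P1\<close>
      and \<open>P2\<close> carries to \<open>E\<close>.\<close>
    define E' where "E' = ?Q1 ** E ** P2"
    note PQ1 = matrix_inv_right[OF inv(1)] matrix_inv_left[OF inv(1)]
    note PQ2 = matrix_inv_right[OF inv(2)] matrix_inv_left[OF inv(2)]
    define P Q where "P = block_upper P1 0 P2" and "Q = block_upper ?Q1 0 ?Q2"
    have PQ: "P ** Q = mat 1" "Q ** P = mat 1"
      by (simp_all add: P_def Q_def block_upper_mult PQ1 PQ2 block_upper_mat[symmetric])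
    have conj: "P ** block_upper X Y Z ** Q = block_upper (P1 ** X ** ?Q1) (P1 ** Y ** ?Q2) (P2 ** Z ** ?Q2)"
      for X Y Z by (simp add: P_def Q_def block_upper_mult)
    have "P1 ** E' ** ?Q2 = (P1 ** ?Q1) ** E ** (P2 ** ?Q2)"
      unfolding E'_def by (simp only: matrix_mul_assoc)
    then have M: "P ** block_upper T1 E' T2 ** Q = block_upper A E B"
      by (simp add: conj A B PQ1 PQ2)
    have "spectrum (block_upper T1 E' T2) = spectrum (block_upper A E B)"
      using spectrum_similar[OF PQ, of "block_upper T1 E' T2"] M by simp
    then have enc_T: "encloses_spectrum \<Gamma> \<Omega> (spectrum (block_upper T1 E' T2))"
      using enc_M by simp
    have "path_image \<Gamma> \<inter> (spectrum T1 \<union> spectrum T2) = {}"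
      using disj spectrum_similar[OF PQ1, of T1] spectrum_similar[OF PQ2, of T2] A B by simp
    note blockT = matrix_fun_block_upper[OF this]
    have "matrix_fun \<Gamma> f (block_upper A E B) = P ** matrix_fun \<Gamma> f (block_upper T1 E' T2) ** Q"
      using matrix_fun_similar[OF \<Omega> enc_T f PQ spectrum_similar[OF PQ]] M by simp
    then show ?thesis
      unfolding block blockT conj block_upper_eq_iff E'_def by blast
  qed

  have const: "D_op \<Gamma> f A B E = 0" if const: "f constant_on \<Omega>" for E :: "complex^'d^'n"
  proof -
    obtain c where "\<And>z. z \<in> \<Omega> \<Longrightarrow> f z = c" using const unfolding constant_on_def by blast
    then have "matrix_fun \<Gamma> f (block_upper A E B) = mat c"
      by (rule matrix_fun_const[OF \<Omega> enc_M])
    \<comment> \<open>A scalar matrix has zero corner.\<close>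
    then show ?thesis unfolding block block_upper_mat block_upper_eq_iff by blast
  qed

  have sum: "D_op \<Gamma> (\<lambda>z. f z + g z) A B E = D_op \<Gamma> f A B E + D_op \<Gamma> g A B E" for E :: "complex^'d^'n"
    using matrix_fun_add[OF \<Omega> enc_M f g, of E]
    unfolding block block_upper_add block_upper_eq_iff by blast

  \<comment> \<open>The Leibniz rule is the corner of a product of two block triangular
    matrices.\<close>
  have product: "D_op \<Gamma> (\<lambda>z. f z * g z) A B E =
      matrix_fun \<Gamma> f A ** D_op \<Gamma> g A B E + D_op \<Gamma> f A B E ** matrix_fun \<Gamma> g B" for E :: "complex^'d^'n"
    using matrix_fun_mult[OF \<Omega> enc_M f g, of E]
    unfolding block block_upper_mult block_upper_eq_iff by blast

  have chain: "D_op \<Gamma>' (f \<circ> g) A B E =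
      D_op \<Gamma> f (matrix_fun \<Gamma> g A) (matrix_fun \<Gamma> g B) (D_op \<Gamma> g A B E)"
    if inside: "spectrum (matrix_fun \<Gamma> g A) \<union> spectrum (matrix_fun \<Gamma> g B) \<subseteq> inside (path_image \<Gamma>)"
      and \<Omega>': "open \<Omega>'" "simply_connected \<Omega>'" and fg: "(f \<circ> g) analytic_on \<Omega>'"
      and enc': "encloses_spectrum \<Gamma>' \<Omega>' (spectrum A \<union> spectrum B)"
    for \<Omega>' \<Gamma>' and E :: "complex^'d^'n"
  proof -
    have ne: "spectrum A \<union> spectrum B \<noteq> {}" using spectrum_nonempty by blast
    have enc_g: "encloses_spectrum \<Gamma> \<Omega> (spectrum (matrix_fun \<Gamma> g A) \<union> spectrum (matrix_fun \<Gamma> g B))"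
      by (rule encloses_spectrum_inside[OF enc ne inside])
    \<comment> \<open>\<open>g(M)\<close> is again block triangular, with diagonal blocks
      \<open>g(A)\<close>, \<open>g(B)\<close> and corner \<open>D_op \<Gamma> g A B E\<close>. Its
      spectrum is therefore enclosed, and the corner of \<open>f(g(M))\<close> is the right-hand
      side of the chain rule.\<close>
    have enc_gM: "encloses_spectrum \<Gamma> \<Omega> (spectrum (matrix_fun \<Gamma> g (block_upper A E B)))"
      unfolding block by (rule encloses_spectrum_mono[OF enc_g spectrum_block_upper])
    have "matrix_fun \<Gamma>' (f \<circ> g) (block_upper A E B) = matrix_fun \<Gamma> f (matrix_fun \<Gamma> g (block_upper A E B))"
      using \<Omega> f g enc_M enc_gM \<Omega>' analytic_imp_holomorphic[OF fg]
        encloses_spectrum_mono[OF enc' spectrum_block_upper]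
      by (rule matrix_fun_compose)
    then show ?thesis
      unfolding block matrix_fun_block_upper[OF encloses_spectrum_disjoint[OF enc']]
        matrix_fun_block_upper[OF encloses_spectrum_disjoint[OF enc_g]] block_upper_eq_iff by blast
  qed

  show ?thesis
    using Frechet similar const sum product chain by blast
qed

end
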